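(* Let $n\ge2$ and $\rho=2/(n+1)$. There are constants $c_n,C_n>0$ and $\alpha_n\in(0,1)$, depending only on $n$, such that $$c_n(1-\alpha)^\rho\le\mathcal{C}_n(\alpha)-1\le C_n(1-\alpha)^\rho\qquad\text{for all }\alpha_n<\alpha<1.$$
   Context: All balls are open Euclidean balls in $\mathbb{R}^n$ with positive radii, and $|\cdot|$ applied to a set denotes Lebesgue measure. For a locally integrable function $f$ on $\mathbb{R}^n$, the uncentered Hardy--Littlewood maximal function is $$Mf(x)=\sup_{B\ni x}\frac1{|B|}\int_B|f(y)|\,dy,$$ where the supremum is over all balls $B$ containing $x$. For $0<\alpha<1$, the sharp Tauberian constant is $$\mathcal{C}_n(\alpha)=\sup_{0<|E|<\infty}\frac{|\{x\in\mathbb{R}^n: M\mathbf{1}_E(x)>\alpha\}|}{|E|},$$ where the supremum is over measurable sets $E\subset\mathbb{R}^n$ with $0<|E|<\infty$, and $\mathbf{1}_E$ is the indicator function of $E$. *)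

theory Defs
  imports "HOL-Analysis.Analysis"
begin

(* The averages are taken in ennreal, so Mf x = \<infinity> is allowed. *)
definition hl_maximal :: "('a::euclidean_space \<Rightarrow> real) \<Rightarrow> 'a \<Rightarrow> ennreal" where
  "hl_maximal f x =
     (SUP (c, r) \<in> {(c, r). 0 < r \<and> x \<in> ball c r}.
        (\<integral>\<^sup>+ y \<in> ball c r. ennreal \<bar>f y\<bar> \<partial>lebesgue) / emeasure lebesgue (ball c r))"

(* The ambient space is passed as a type argument: C_n(\<alpha>) is
   tauberian_const TYPE(real^'n) \<alpha> with n = CARD('n).
   The supremum is taken in ennreal, so it is not silently 0 if unbounded. *)
definition tauberian_const :: "'a::euclidean_space itself \<Rightarrow> real \<Rightarrow> ennreal" where
  "tauberian_const _ \<alpha> =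
     (SUP E \<in> {E :: 'a set. E \<in> sets lebesgue \<and> 0 < emeasure lebesgue E \<and> emeasure lebesgue E < \<infinity>}.
        emeasure lebesgue {x. hl_maximal (indicator E) x > ennreal \<alpha>} / emeasure lebesgue E)"

end

theory Submission
  imports Defs
begin

text \<open>Write \<open>\<eta> = (1 - \<alpha>) powr (1 / (n + 1))\<close>, so that the claimed order of magnitude is \<open>\<eta>\<^sup>2\<close>.

  Lower bound: a ball of radius \<open>1/4\<close> pushed out of a facet of the unit cube by
  \<open>h \<approx> \<eta>\<^sup>2\<close> loses a cap of volume \<open>O(h powr ((n + 1) / 2))\<close>, that is, a fraction at most
  \<open>\<eta> ^ (n + 1)\<close>, and such balls cover a slab of height \<open>h\<close> above the facet.

  Upper bound: from finitely many balls with union \<open>F\<close> one selects balls \<open>B\<^sub>j\<close> of total measure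
  \<open>O(\<eta> powr (1 - n)) * |F|\<close> that still cover all balls shrunk by the factor \<open>1 - 32 * \<eta>\<^sup>2\<close>.
  Dilating the balls of a family by \<open>l\<close> increases the measure of their union at most by
  \<open>l ^ n\<close>, so the \<open>B\<^sub>j\<close> cover \<open>F\<close> up to measure \<open>O(\<eta>\<^sup>2) * |F|\<close>, while outside \<open>E\<close> they have total
  measure at most \<open>\<eta> ^ (n + 1) * O(\<eta> powr (1 - n)) * |F| = O(\<eta>\<^sup>2) * |F|\<close>.

  For balls of radii in \<open>{R..<2 * R}\<close> let \<open>S\<close> be the set of centres of all balls of radius \<open>R\<close>
  contained in one of them. As in Dudley's approximation of convex bodies, one takes an
  \<open>\<eta> * R\<close>-net of the surface at distance \<open>R/4\<close> from \<open>S\<close> together with nearest points in \<open>S\<close>; replacing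
  the nearest point of \<open>y\<close> by that of a net point next to the segment changes the distance to
  \<open>y\<close> only by \<open>O(\<eta>\<^sup>2 * R)\<close>. Different dyadic scales decouple, because a ball that is not covered by the
  balls of at least twice its radius contains a ball of comparable size, and these smaller balls
  are disjoint for scales that are not adjacent.\<close>

subsection \<open>Dilating the balls of a finite family\<close>

lemma measure_ball:
  fixes c :: "'a::euclidean_space"
  assumes "0 \<le> r"
  shows "measure lebesgue (ball c r) = unit_ball_vol (DIM('a)) * r ^ DIM('a)"
  using content_ball[OF assms, of c] by simp

lemma lmeasurable_UN_ball [simp]:
  fixes J :: "('a::euclidean_space \<times> real) set"
  assumes "finite J"
  shows "(\<Union>(c, r)\<in>J. ball c (f r)) \<in> lmeasurable"
  using assms by (intro fmeasurable.finite_UN) auto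

lemma
  fixes A :: "'a::euclidean_space set"
  assumes "0 < l" and A: "A \<in> lmeasurable"
  shows lmeasurable_homothety: "(\<lambda>y. x + l *\<^sub>R (y - x)) ` A \<in> lmeasurable" (is "?h ` A \<in> _")
    and measure_homothety:
      "measure lebesgue ((\<lambda>y. x + l *\<^sub>R (y - x)) ` A) = l ^ DIM('a) * measure lebesgue A"
proof -
  have "(*\<^sub>R) l ` A = (*\<^sub>R) (1 / l) -` A \<inter> space lebesgue"
    using assms(1) by (auto intro!: image_eqI[where x = "y /\<^sub>R l" for y] simp: inverse_eq_divide)
  then have "(*\<^sub>R) l ` A \<in> sets lebesgue"
    using measurable_sets[OF lebesgue_measurable_scaling fmeasurableD[OF A]] by metis
  moreover have im: "?h ` A = (+) (x - l *\<^sub>R x) ` ((*\<^sub>R) l ` A)"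
    unfolding image_image by (intro image_cong) (auto simp: algebra_simps)
  ultimately have sets: "?h ` A \<in> sets lebesgue"
    by (simp add: lebesgue_sets_translation)
  have "?h ` A = (\<lambda>y. l *\<^sub>R y + (x - l *\<^sub>R x)) ` A"
    by (intro image_cong) (auto simp: algebra_simps)
  then have em: "emeasure lebesgue (?h ` A) = l ^ DIM('a) * emeasure lebesgue A"
    using emeasure_lebesgue_affine[of l "x - l *\<^sub>R x" A] assms by (simp add: add.commute)
  show "?h ` A \<in> lmeasurable"
    using sets em fmeasurableD2[OF A] by (auto simp: fmeasurable_def ennreal_mult_less_top less_top)
  show "measure lebesgue (?h ` A) = l ^ DIM('a) * measure lebesgue A"
    using em assms by (simp add: measure_def enn2real_mult)
qed

text \<open>Let w be y contracted towards x by the factor l. Then y - c = (w - c) + (1 - 1/l) * (y -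
  x), and the last term has norm at most (l - 1) * s because \<open>r \<le> s\<close>. So
  contracting towards the centre of a smaller ball cannot carry a point from outside a dilated
  larger ball into the larger ball itself.\<close>

lemma homothety_avoids_larger_ball:
  fixes x y c :: "'a::real_normed_vector"
  assumes "1 \<le> l" "r \<le> s" "dist x y < l * r" "dist c (x + (y - x) /\<^sub>R l) < s"
  shows "dist c y < l * s"
proof -
  have l: "0 < l" using assms by simp
  let ?w = "x + (y - x) /\<^sub>R l"
  have "y - c = (?w - c) + (1 - 1 / l) *\<^sub>R (y - x)"
    by (simp add: algebra_simps inverse_eq_divide)
  then have "norm (y - c) \<le> norm (?w - c) + norm ((1 - 1 / l) *\<^sub>R (y - x))"
    using norm_triangle_ineq[of "?w - c"] by presburger
  also have "norm ((1 - 1 / l) *\<^sub>R (y - x)) = (1 - 1 / l) * dist x y"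
    using assms l by (simp add: dist_norm norm_minus_commute)
  also have "(1 - 1 / l) * dist x y \<le> (1 - 1 / l) * (l * s)"
    using assms l by (intro mult_left_mono order_trans[OF less_imp_le[OF assms(3)]]) (auto simp: field_simps)
  also have "(1 - 1 / l) * (l * s) = l * s - s"
    using l by (simp add: field_simps)
  finally show ?thesis
    using assms(4) by (simp add: dist_norm norm_minus_commute)
qed

text \<open>Balls are added in order of decreasing radius. What the dilate of the newest, smallest
  ball adds to the dilated union lies in the image, under the homothety about its own centre, of
  what the ball adds to the original union. Each increment therefore grows at most by
  \<open>l ^ DIM('a)\<close>.\<close>

lemma measure_UN_ball_dilate_le:
  fixes J :: "('a::euclidean_space \<times> real) set"
  assumes "finite J" and l: "1 \<le> l"
  shows "measure lebesgue (\<Union>(c, r)\<in>J. ball c (l * r)) \<le>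
    l ^ DIM('a) * measure lebesgue (\<Union>(c, r)\<in>J. ball c r)"
  using assms(1)
proof (induction J rule: finite_ranking_induct[where f = "\<lambda>p. - snd p"])
  case empty
  then show ?case by simp
next
  case (insert p J)
  obtain x r where p: "p = (x, r)" by force
  define A where "A m = (\<Union>(c, r)\<in>J. ball c (m * r))" for m
  have A1: "A 1 = (\<Union>(c, r)\<in>J. ball c r)" by (simp add: A_def)
  have meas[simp]: "A m \<in> lmeasurable" for m
    using insert.hyps lmeasurable_UN_ball[of J "\<lambda>r. m * r"] by (simp add: A_def)
  have sub: "ball x (l * r) - A l \<subseteq> (\<lambda>y. x + l *\<^sub>R (y - x)) ` (ball x r - A 1)"
  proof
    fix y assume y: "y \<in> ball x (l * r) - A l"
    let ?w = "x + (y - x) /\<^sub>R l"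
    have "norm ((y - x) /\<^sub>R l) < r"
      using y l by (simp add: dist_norm norm_minus_commute pos_divide_less_eq divide_inverse[symmetric] mult.commute[of "inverse l"] mult.commute[of r])
    then have "?w \<in> ball x r" by (simp add: dist_norm)
    moreover have "?w \<notin> A 1"
    proof
      assume "?w \<in> A 1"
      then obtain c s where cs: "(c, s) \<in> J" "dist c ?w < s" by (auto simp: A_def)
      then have "r \<le> s" using insert.hyps(2) p by force
      from homothety_avoids_larger_ball[OF l this _ cs(2)] y have "dist c y < l * s" by simp
      with cs y show False by (auto simp: A_def)
    qed
    moreover have "y = x + l *\<^sub>R (?w - x)" using l by simp
    ultimately show "y \<in> (\<lambda>y. x + l *\<^sub>R (y - x)) ` (ball x r - A 1)" by blast
  qed
  have lm: "ball x r - A 1 \<in> lmeasurable" by (intro fmeasurable.Diff) auto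
  have "measure lebesgue (\<Union>(c, r)\<in>insert p J. ball c (l * r)) = measure lebesgue (A l \<union> ball x (l * r))"
    by (simp add: p A_def Un_commute)
  also have "\<dots> = measure lebesgue (A l) + measure lebesgue (ball x (l * r) - A l)"
    by (rule measure_Un2) auto
  also have "measure lebesgue (ball x (l * r) - A l) \<le> measure lebesgue ((\<lambda>y. x + l *\<^sub>R (y - x)) ` (ball x r - A 1))"
  proof (rule measure_mono_fmeasurable[OF sub])
    show "ball x (l * r) - A l \<in> sets lebesgue" by (intro fmeasurableD fmeasurable.Diff) auto
    show "(\<lambda>y. x + l *\<^sub>R (y - x)) ` (ball x r - A 1) \<in> lmeasurable"
      using l lm by (intro lmeasurable_homothety) auto
  qed
  also have "\<dots> = l ^ DIM('a) * measure lebesgue (ball x r - A 1)"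
    using l lm by (intro measure_homothety) auto
  also have "measure lebesgue (A l) \<le> l ^ DIM('a) * measure lebesgue (A 1)"
    using insert.IH by (simp add: A_def)
  finally have "measure lebesgue (\<Union>(c, r)\<in>insert p J. ball c (l * r)) \<le>
    l ^ DIM('a) * (measure lebesgue (A 1) + measure lebesgue (ball x r - A 1))"
    by (simp add: algebra_simps)
  also have "measure lebesgue (A 1) + measure lebesgue (ball x r - A 1) = measure lebesgue (A 1 \<union> ball x r)"
    by (rule measure_Un2[symmetric]) auto
  also have "A 1 \<union> ball x r = (\<Union>(c, r)\<in>insert p J. ball c r)"
    by (simp add: p A_def Un_commute)
  finally show ?case .
qed

section \<open>Nearest points and separated nets\<close>

text \<open>The origin plays a nearest point to w, and v the nearest point chosen for the net point
  \<open>t *\<^sub>R w + u\<close>, where u is the net error. By \<open>vw\<close>, w is no closer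
  to v than to the origin; by \<open>vz\<close>, the net point is no closer to the origin than to v.
  Together they force norm v = O(h), and make the change of the squared distance quadratic in
  h.\<close>

lemma nearest_centre_stable:
  fixes v w u :: "'a::real_inner"
  assumes t: "1/4 \<le> t" "t \<le> 1/2"
    and vw: "2 * (v \<bullet> w) \<le> v \<bullet> v"
    and vz: "v \<bullet> v \<le> 2 * t * (v \<bullet> w) + 2 * (v \<bullet> u)"
    and u: "norm u \<le> h"
  shows "(norm (w - v))\<^sup>2 \<le> (norm w)\<^sup>2 + 32 * h\<^sup>2"
proof -
  have vu: "v \<bullet> u \<le> norm v * h"
    using order_trans[OF norm_cauchy_schwarz mult_left_mono[OF u]] by simp
  have vv: "v \<bullet> v = norm v * norm v" by (simp add: dot_square_norm power2_eq_square)
  have h: "0 \<le> h" using u norm_ge_zero order_trans by blast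
  \<comment> \<open>Because \<open>t \<le> 1/2\<close>, half of \<open>v \<bullet> v\<close> is
    absorbed in \<open>vz\<close>, which leaves the first-order bound on
    \<open>norm v\<close>.\<close>
  have tvw: "2 * t * (v \<bullet> w) \<le> (v \<bullet> v) / 2"
  proof (cases "0 \<le> v \<bullet> w")
    case True
    have "t * (v \<bullet> w) \<le> 1/2 * (v \<bullet> w)" using True t by (intro mult_right_mono) auto
    then show ?thesis using vw by simp
  next
    case False
    then have "t * (v \<bullet> w) \<le> 0" using t by (intro mult_nonneg_nonpos) auto
    then show ?thesis using inner_ge_zero[of v] by linarith
  qed
  have "norm v * norm v \<le> norm v * (4 * h)" using vz tvw vu vv by simp
  then have nv: "norm v \<le> 4 * h"
    using h by (cases "norm v = 0") (simp_all add: mult_le_cancel_left_pos)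
  \<comment> \<open>Feeding \<open>norm v \<le> 4 * h\<close> back into the term with u turns a
    first-order error into one of order h^2.\<close>
  have "norm v * h \<le> 4 * h * h" using nv h by (intro mult_right_mono) auto
  then have a: "v \<bullet> v - 8 * (h * h) \<le> 2 * t * (v \<bullet> w)" using vz vu by simp
  have "- 2 * (v \<bullet> w) \<le> 32 * (h * h) - v \<bullet> v"
  proof (cases "0 \<le> v \<bullet> w")
    case True
    have "t * (v \<bullet> w) \<le> 1/2 * (v \<bullet> w)" using True t by (intro mult_right_mono) auto
    then have "v \<bullet> v \<le> 8 * (h * h) + v \<bullet> w" using a by simp
    then show ?thesis using True mult_nonneg_nonneg[OF h h] by linarith
  next
    case False
    have "t * (v \<bullet> w) \<le> 1/4 * (v \<bullet> w)" using False t by (intro mult_right_mono_neg) auto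
    then have "v \<bullet> v \<le> 8 * (h * h) + (v \<bullet> w) / 2" using a by simp
    then show ?thesis using inner_ge_zero[of v] by linarith
  qed
  moreover have "(norm (w - v))\<^sup>2 = (norm w)\<^sup>2 - 2 * (v \<bullet> w) + v \<bullet> v"
    by (simp add: power2_norm_eq_inner inner_diff inner_commute)
  ultimately show ?thesis
    by (simp add: power2_eq_square)
qed

text \<open>The a priori bound N replaces compactness: a separated subset of largest cardinality
  exists, and a point at distance at least h from all of it could still be added.\<close>

lemma maximal_separated_subset:
  fixes Z :: "'a::metric_space set"
  assumes "\<And>T. \<lbrakk>finite T; T \<subseteq> Z; \<And>x y. \<lbrakk>x \<in> T; y \<in> T; x \<noteq> y\<rbrakk> \<Longrightarrow> h \<le> dist x y\<rbrakk> \<Longrightarrow> card T \<le> N"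
    and "0 < h"
  obtains T where "finite T" "T \<subseteq> Z" "\<And>x y. \<lbrakk>x \<in> T; y \<in> T; x \<noteq> y\<rbrakk> \<Longrightarrow> h \<le> dist x y"
    "\<And>z. z \<in> Z \<Longrightarrow> \<exists>t\<in>T. dist z t < h"
proof -
  define P where "P T \<longleftrightarrow> finite T \<and> T \<subseteq> Z \<and> (\<forall>x\<in>T. \<forall>y\<in>T. x \<noteq> y \<longrightarrow> h \<le> dist x y)" for T
  have "P {}" by (simp add: P_def)
  moreover have bd: "\<forall>T. P T \<longrightarrow> card T < Suc N"
    using assms(1) by (auto simp: P_def less_Suc_eq_le)
  ultimately obtain T where T: "P T" "\<And>T'. P T' \<Longrightarrow> card T' \<le> card T"
    using ex_has_greatest_nat[of P "{}" card "Suc N"] by auto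
  have "\<exists>t\<in>T. dist z t < h" if "z \<in> Z" for z
  proof (rule ccontr)
    assume c: "\<not> ?thesis"
    then have far: "h \<le> dist z t" "h \<le> dist t z" if "t \<in> T" for t
      using that by (force simp: not_less dist_commute)+
    then have "P (insert z T)" using T(1) that by (auto simp: P_def)
    moreover have "z \<notin> T" using far(1)[of z] assms(2) by auto
    ultimately show False using T(2)[of "insert z T"] T(1) by (simp add: P_def)
  qed
  then show thesis using T(1) by (intro that[of T]) (auto simp: P_def)
qed

subsection \<open>Covering at a single scale\<close>

lemma measure_UN_separated_balls:
  fixes T :: "'a::euclidean_space set"
  assumes "finite T" "0 \<le> h" "\<And>x y. \<lbrakk>x \<in> T; y \<in> T; x \<noteq> y\<rbrakk> \<Longrightarrow> h \<le> dist x y"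
  shows "measure lebesgue (\<Union>z\<in>T. ball z (h / 2)) = real (card T) * (unit_ball_vol (DIM('a)) * (h / 2) ^ DIM('a))"
proof -
  have "disjnt (ball x (h / 2)) (ball y (h / 2))" if "x \<in> T" "y \<in> T" "x \<noteq> y" for x y
    using assms(3)[OF that] by (intro disjoint_ballI[folded disjnt_def]) auto
  then have "measure lebesgue (\<Union>z\<in>T. ball z (h / 2)) = (\<Sum>z\<in>T. measure lebesgue (ball z (h / 2)))"
    using assms(1) by (intro measure_UNION') (auto simp: pairwise_def)
  also have "\<dots> = (\<Sum>z\<in>T. unit_ball_vol (DIM('a)) * (h / 2) ^ DIM('a))"
    using assms(2) by (intro sum.cong refl measure_ball) auto
  finally show ?thesis by simp
qed

text \<open>Applied with x = 8 * \<eta>; being linear in x, the excess over 1 supplies the factor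
  \<eta> in the neighbourhood estimate.\<close>

lemma power_one_plus_le:
  fixes x :: real
  assumes "0 \<le> x" "x \<le> 2"
  shows "(1 + x) ^ n \<le> 1 + x * 4 ^ n"
proof (induction n)
  case 0
  then show ?case using assms by simp
next
  case (Suc n)
  have 1: "(1::real) \<le> 4 ^ n" by simp
  have "(1 + x) ^ Suc n \<le> (1 + x) * (1 + x * 4 ^ n)"
    using Suc assms by (simp add: mult_left_mono)
  also have "\<dots> = 1 + x + (x * 4 ^ n) * (1 + x)" by (simp add: algebra_simps)
  also have "\<dots> \<le> 1 + x * 4 ^ n + (x * 4 ^ n) * 3"
    using assms mult_left_mono[OF 1, of x] by (intro add_mono mult_left_mono) auto
  finally show ?case by simp
qed

text \<open>The separated points lie on a level surface of the distance to \<open>S\<close>. By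
  \<open>measure_UN_ball_dilate_le\<close>, its \<open>\<eta> R / 2\<close>-neighbourhood has measure \<open>O(\<eta>)\<close>, which is
  where the exponent \<open>DIM('a) - 1\<close> instead of \<open>DIM('a)\<close> comes from.\<close>

lemma card_separated_on_level_surface:
  fixes S T F :: "'a::euclidean_space set"
  assumes \<eta>: "0 < \<eta>" "\<eta> \<le> 1/8" and R: "0 < R"
    and F: "F \<in> lmeasurable" "\<And>c. c \<in> S \<Longrightarrow> ball c R \<subseteq> F"
    and T: "finite T" "\<And>x y. \<lbrakk>x \<in> T; y \<in> T; x \<noteq> y\<rbrakk> \<Longrightarrow> \<eta> * R \<le> dist x y"
    and f: "\<And>z. z \<in> T \<Longrightarrow> \<exists>c\<in>S. dist z c = R / 4"
    and far: "\<And>z c. \<lbrakk>z \<in> T; c \<in> S\<rbrakk> \<Longrightarrow> R / 4 \<le> dist z c"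
  shows "real (card T) * (unit_ball_vol (DIM('a)) * R ^ DIM('a)) * \<eta> ^ (DIM('a) - 1)
    \<le> 8 * 8 ^ DIM('a) * measure lebesgue F"
proof -
  let ?n = "DIM('a)"
  from f obtain g where g: "\<And>z. z \<in> T \<Longrightarrow> g z \<in> S" "\<And>z. z \<in> T \<Longrightarrow> dist z (g z) = R / 4"
    by metis
  \<comment> \<open>Balls of radius r about the points \<open>g z\<close> miss the balls of radius
    \<eta> * R / 2 about T, by \<open>far\<close>; dilated by l, to radius (1/4 + \<eta>/2) * R,
    they contain them.\<close>
  define r where "r = (1/4 - \<eta> / 2) * R"
  define l where "l = (1 + 2 * \<eta>) / (1 - 2 * \<eta>)"
  have lr: "l * r = (1/4 + \<eta> / 2) * R"
    using \<eta> by (simp add: l_def r_def field_simps)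
  have r: "0 < r" using \<eta> R by (simp add: r_def)
  have l: "1 \<le> l" "l \<le> 1 + 8 * \<eta>"
    using \<eta> mult_mono[of \<eta> "1/8" \<eta> \<eta>] by (simp_all add: l_def field_simps)
  define J where "J = (\<lambda>z. (g z, r)) ` T"
  define A where "A m = (\<Union>(c, r)\<in>J. ball c (m * r))" for m
  have A_eq: "A m = (\<Union>z\<in>T. ball (g z) (m * r))" for m by (simp add: A_def J_def)
  have fin: "finite J" using T by (simp add: J_def)
  have Am[simp]: "A m \<in> lmeasurable" for m
    using lmeasurable_UN_ball[OF fin, of "\<lambda>r. m * r"] by (simp add: A_def)
  have A1: "A 1 = (\<Union>(c, r)\<in>J. ball c r)" by (simp add: A_def)
  define B where "B = (\<Union>z\<in>T. ball z (\<eta> * R / 2))"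
  have Bm[simp]: "B \<in> lmeasurable" using T by (auto simp: B_def)
  have "A 1 \<inter> B = {}"
  proof -
    have False if "z \<in> T" "z' \<in> T" "dist (g z) x < r" "dist z' x < \<eta> * R / 2" for z z' x
    proof -
      have "dist z' (g z) \<le> dist z' x + dist (g z) x" by (rule dist_triangle2)
      also have "\<dots> < r + \<eta> * R / 2" using that by linarith
      also have "\<dots> = R / 4" by (simp add: r_def algebra_simps)
      finally show False using far[OF that(2) g(1)[OF that(1)]] by simp
    qed
    then show ?thesis by (auto simp: A_eq B_def)
  qed
  then have "measure lebesgue (A 1) + measure lebesgue B = measure lebesgue (A 1 \<union> B)"
    using measure_Un3[of "A 1" lebesgue B] by simp
  also have "A 1 \<union> B \<subseteq> A l"
  proof -
    have "dist (g z) x < (1/4 + \<eta> / 2) * R" if "z \<in> T" "dist z x < \<eta> * R / 2" for z x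
      using dist_triangle[of "g z" x z] g(2)[OF that(1)] that(2) by (simp add: dist_commute algebra_simps)
    then have "B \<subseteq> A l" by (auto simp: A_eq B_def lr)
    moreover have "1 * r \<le> l * r" using r l by (intro mult_right_mono) auto
    then have "A 1 \<subseteq> A l" unfolding A_eq by (intro UN_mono subset_ball order_refl) auto
    ultimately show ?thesis by blast
  qed
  then have "measure lebesgue (A 1 \<union> B) \<le> measure lebesgue (A l)"
    by (intro measure_mono_fmeasurable sets.Un fmeasurableD) auto
  also have "\<dots> \<le> l ^ ?n * measure lebesgue (A 1)"
    using fin l unfolding A1 unfolding A_def by (intro measure_UN_ball_dilate_le) auto
  also have "\<dots> \<le> (1 + 8 * \<eta> * 4 ^ ?n) * measure lebesgue (A 1)"
    using l \<eta> by (intro mult_right_mono order_trans[OF power_mono[OF l(2)] power_one_plus_le]) auto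
  finally have "measure lebesgue B \<le> 8 * \<eta> * 4 ^ ?n * measure lebesgue (A 1)"
    by (simp add: algebra_simps)
  also have "\<dots> \<le> 8 * \<eta> * 4 ^ ?n * measure lebesgue F"
  proof -
    have "r \<le> R" using \<eta> R mult_right_mono[of "1/4 - \<eta> / 2" 1 R] by (simp add: r_def)
    then have "A 1 \<subseteq> F" unfolding A_eq using F(2)[OF g(1)] by fastforce
    then show ?thesis using F \<eta> by (intro mult_left_mono measure_mono_fmeasurable fmeasurableD[OF Am]) auto
  qed
  also have "measure lebesgue B = real (card T) * (unit_ball_vol ?n * (\<eta> * R / 2) ^ ?n)"
    unfolding B_def using T \<eta> R by (intro measure_UN_separated_balls) auto
  \<comment> \<open>One factor \<eta> is split off to cancel the one on the other side, leaving
    \<open>DIM('a) - 1\<close> of them.\<close>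
  also have "(\<eta> * R / 2) ^ ?n = \<eta> * \<eta> ^ (?n - 1) * R ^ ?n / 2 ^ ?n"
    using power_minus_mult[of ?n \<eta>] by (simp add: power_mult_distrib power_divide mult.commute)
  finally have "\<eta> * (real (card T) * (unit_ball_vol ?n * R ^ ?n) * \<eta> ^ (?n - 1)) \<le>
      \<eta> * (8 * (2 ^ ?n * 4 ^ ?n) * measure lebesgue F)"
    by (simp add: field_simps)
  moreover have "2 ^ ?n * 4 ^ ?n = (8::real) ^ ?n"
    by (simp flip: power_mult_distrib)
  ultimately show ?thesis using \<eta> by simp
qed

lemma single_scale_covering:
  fixes J :: "('a::euclidean_space \<times> real) set"
  assumes J: "finite J" "\<And>c r. (c, r) \<in> J \<Longrightarrow> R \<le> r"
    and \<eta>: "0 < \<eta>" "\<eta> \<le> 1/8" and R: "0 < R"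
  obtains J' where "J' \<subseteq> J"
    "\<And>c r. (c, r) \<in> J \<Longrightarrow> ball c ((1 - 32 * \<eta>\<^sup>2) * r) \<subseteq> (\<Union>(c, r)\<in>J'. ball c r)"
    "real (card J') * (unit_ball_vol (DIM('a)) * R ^ DIM('a)) * \<eta> ^ (DIM('a) - 1)
      \<le> 16 * 8 ^ DIM('a) * measure lebesgue (\<Union>(c, r)\<in>J. ball c r)"
proof -
  let ?n = "DIM('a)"
  define F where "F = (\<Union>(c, r)\<in>J. ball c r)"
  define V where "V = unit_ball_vol ?n * R ^ ?n"
  have V: "0 < V" using R by (simp add: V_def)
  have F: "F \<in> lmeasurable" using lmeasurable_UN_ball[OF J(1), of "\<lambda>r. r"] by (simp add: F_def)
  \<comment> \<open>A ball of radius R about s fits into \<open>ball c r\<close> when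
    \<open>dist c s \<le> r - R\<close>. As a finite union of closed balls S is closed, so nearest
    points in S exist.\<close>
  define S where "S = (\<Union>(c, r)\<in>J. cball c (r - R))"
  have S_I: "x \<in> S" if "(c, r) \<in> J" "dist c x \<le> r - R" for c r x
    unfolding S_def using that by (intro UN_I[of "(c, r)"]) auto
  have "closed S" unfolding S_def using J by (auto intro!: closed_UN)
  have "\<exists>p. s \<in> S \<longrightarrow> p \<in> J \<and> ball s R \<subseteq> ball (fst p) (snd p)" for s
  proof (cases "s \<in> S")
    case True
    then obtain c r where "(c, r) \<in> J" "dist c s \<le> r - R" by (auto simp: S_def)
    then show ?thesis by (intro exI[of _ "(c, r)"]) (auto simp: ball_subset_ball_iff dist_commute)
  qed auto
  then obtain g where g: "\<And>s. s \<in> S \<Longrightarrow> g s \<in> J" "\<And>s. s \<in> S \<Longrightarrow> ball s R \<subseteq> ball (fst (g s)) (snd (g s))"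
    by metis
  have SF: "ball s R \<subseteq> F" if "s \<in> S" for s
    using g[OF that] by (fastforce simp: F_def)
  \<comment> \<open>The level surface of the distance to S, phrased by an attained minimum instead
    of an infimum.\<close>
  define Z where "Z = {z. (\<exists>c\<in>S. dist z c = R / 4) \<and> (\<forall>c\<in>S. R / 4 \<le> dist z c)}"
  obtain N1 :: nat where N1: "8 * 8 ^ ?n * measure lebesgue F / (V * \<eta> ^ (?n - 1)) \<le> N1"
    using real_arch_simple by blast
  have bound1: "real (card T) * V * \<eta> ^ (?n - 1) \<le> 8 * 8 ^ ?n * measure lebesgue F"
    if "finite T" "T \<subseteq> Z" "\<And>x y. \<lbrakk>x \<in> T; y \<in> T; x \<noteq> y\<rbrakk> \<Longrightarrow> \<eta> * R \<le> dist x y" for T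
    unfolding V_def using that(2)
    by (intro card_separated_on_level_surface[OF \<eta> R F SF that(1,3)]) (auto simp: Z_def)
  have bound1': "card T \<le> N1"
    if "finite T" "T \<subseteq> Z" "\<And>x y. \<lbrakk>x \<in> T; y \<in> T; x \<noteq> y\<rbrakk> \<Longrightarrow> \<eta> * R \<le> dist x y" for T
  proof -
    have "real (card T) \<le> 8 * 8 ^ ?n * measure lebesgue F / (V * \<eta> ^ (?n - 1))"
      using bound1[OF that] V \<eta> by (simp add: field_simps)
    then show ?thesis using N1 by simp
  qed
  obtain T1 where T1: "finite T1" "T1 \<subseteq> Z" "\<And>x y. \<lbrakk>x \<in> T1; y \<in> T1; x \<noteq> y\<rbrakk> \<Longrightarrow> \<eta> * R \<le> dist x y"
    "\<And>z. z \<in> Z \<Longrightarrow> \<exists>t\<in>T1. dist z t < \<eta> * R"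
  proof -
    show ?thesis
      by (rule maximal_separated_subset[of Z "\<eta> * R" N1], fact bound1', use \<eta> R in simp, fact that)
  qed
  \<comment> \<open>Points close to S only need a net of S of the coarse mesh R/2, whose size is
    bounded by packing without a negative power of \<eta>.\<close>
  have bound2: "real (card T) * V \<le> 4 ^ ?n * measure lebesgue F"
    if "finite T" "T \<subseteq> S" "\<And>x y. \<lbrakk>x \<in> T; y \<in> T; x \<noteq> y\<rbrakk> \<Longrightarrow> R / 2 \<le> dist x y" for T
  proof -
    have "real (card T) * (unit_ball_vol ?n * (R / 2 / 2) ^ ?n) = measure lebesgue (\<Union>z\<in>T. ball z (R / 2 / 2))"
      using that R by (intro measure_UN_separated_balls[symmetric]) auto
    also have "\<dots> \<le> measure lebesgue F"
    proof (rule measure_mono_fmeasurable[OF _ _ F])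
      have "ball z (R / 2 / 2) \<subseteq> ball z R" for z :: 'a
        using R by (intro subset_ball) simp
      then show "(\<Union>z\<in>T. ball z (R / 2 / 2)) \<subseteq> F" using SF \<open>T \<subseteq> S\<close> by blast
    qed (use \<open>finite T\<close> in \<open>auto intro!: sets.finite_UN\<close>)
    finally show ?thesis by (simp add: V_def power_divide field_simps)
  qed
  obtain N2 :: nat where N2: "4 ^ ?n * measure lebesgue F / V \<le> N2"
    using real_arch_simple by blast
  have bound2': "card T \<le> N2"
    if "finite T" "T \<subseteq> S" "\<And>x y. \<lbrakk>x \<in> T; y \<in> T; x \<noteq> y\<rbrakk> \<Longrightarrow> R / 2 \<le> dist x y" for T
  proof -
    have "real (card T) \<le> 4 ^ ?n * measure lebesgue F / V"
      using bound2[OF that] V by (simp add: field_simps)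
    then show ?thesis using N2 by simp
  qed
  obtain T2 where T2: "finite T2" "T2 \<subseteq> S" "\<And>x y. \<lbrakk>x \<in> T2; y \<in> T2; x \<noteq> y\<rbrakk> \<Longrightarrow> R / 2 \<le> dist x y"
    "\<And>z. z \<in> S \<Longrightarrow> \<exists>t\<in>T2. dist z t < R / 2"
  proof -
    show ?thesis
      by (rule maximal_separated_subset[of S "R / 2" N2], fact bound2', use R in simp, fact that)
  qed
  have "\<exists>c. z \<in> T1 \<longrightarrow> c \<in> S \<and> dist z c = R / 4" for z
    using T1(2) by (auto simp: Z_def)
  then obtain f where f: "\<And>z. z \<in> T1 \<Longrightarrow> f z \<in> S" "\<And>z. z \<in> T1 \<Longrightarrow> dist z (f z) = R / 4"
    by metis
  \<comment> \<open>Each selected centre is replaced by a member of J containing the ball of radius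
    R about it.\<close>
  define J' where "J' = g ` (f ` T1 \<union> T2)"
  have J'ball: "y \<in> (\<Union>(c, r)\<in>J'. ball c r)" if "q \<in> f ` T1 \<union> T2" "dist y q < R" for q y
  proof -
    have "q \<in> S" using that f T2 by auto
    moreover have "y \<in> ball q R" using that(2) by (simp add: dist_commute)
    ultimately have "y \<in> ball (fst (g q)) (snd (g q))" using g(2) by blast
    then show ?thesis using that(1) unfolding J'_def by force
  qed
  define a where "a = 32 * \<eta>\<^sup>2"
  have a: "0 < a" "a < 1"
    using \<eta> power_mono[of \<eta> "1/8" 2] by (auto simp: a_def power2_eq_square)
  have cover: "y \<in> (\<Union>(c, r)\<in>J'. ball c r)" if cr: "(c, r) \<in> J" "dist c y < (1 - a) * r" for c r y
  proof -
    have r: "R \<le> r" "0 < r" using J(2)[OF cr(1)] R by auto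
    \<comment> \<open>If y is farther than r - R from c, take s on the segment from c to y at
      distance r - R from c. Then dist y s < (1 - a) * r - (r - R) = R - a * r, and
      \<open>R \<le> r\<close>.\<close>
    have "\<exists>s\<in>S. dist y s \<le> (1 - a) * R"
    proof (cases "dist c y \<le> r - R")
      case True
      then have "y \<in> S" by (rule S_I[OF cr(1)])
      then show ?thesis using a R by (intro bexI[of _ y]) auto
    next
      case False
      let ?d = "dist c y"
      define s where "s = c + ((r - R) / ?d) *\<^sub>R (y - c)"
      have d: "0 < ?d" using False r by linarith
      then have ys: "y - s = (1 - (r - R) / ?d) *\<^sub>R (y - c)"
        by (simp add: s_def algebra_simps)
      have "dist c s = (r - R) / ?d * ?d" using r d by (simp add: s_def dist_norm norm_minus_commute)
      then have "dist c s \<le> r - R" using d by simp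
      then have "s \<in> S" by (rule S_I[OF cr(1)])
      moreover have "dist y s = (1 - (r - R) / ?d) * ?d"
        unfolding dist_norm[of y s] ys using False d by (simp add: dist_norm norm_minus_commute)
      then have "dist y s = ?d - (r - R)"
        using d left_diff_distrib[of 1 "(r - R) / ?d" ?d] by simp
      then have "dist y s \<le> (1 - a) * R"
        using cr(2) mult_left_mono[OF r(1), of a] a(1) left_diff_distrib[of 1 a r] left_diff_distrib[of 1 a R]
        by linarith
      ultimately show ?thesis by blast
    qed
    then obtain s where s: "s \<in> S" "dist y s \<le> (1 - a) * R" by blast
    then obtain p where p: "p \<in> S" "\<And>q. q \<in> S \<Longrightarrow> dist y p \<le> dist y q"
      using distance_attains_inf[OF \<open>closed S\<close>, of y] by blast
    have py: "dist y p \<le> (1 - a) * R" using p(2)[OF s(1)] s(2) by linarith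
    show ?thesis
    proof (cases "dist y p < R / 2")
      case True
      obtain t where "t \<in> T2" "dist p t < R / 2" using T2(4)[OF p(1)] by blast
      then show ?thesis using True dist_triangle[of y t p] by (intro J'ball[of t]) auto
    next
      case False
      let ?\<rho> = "dist y p"
      have \<rho>: "R / 2 \<le> ?\<rho>" "0 < ?\<rho>" using False R by auto
      \<comment> \<open>The point z below lies on the segment from p to y at distance R/4 from p.
        Since \<open>?\<rho>\<close> is between R/2 and R, t is in the range required by
        \<open>nearest_centre_stable\<close>.\<close>
      define t where "t = R / (4 * ?\<rho>)"
      have "?\<rho> \<le> R" using py mult_right_mono[of "1 - a" 1 R] a R by linarith
      then have t: "1/4 \<le> t" "t \<le> 1/2" using \<rho> by (simp_all add: t_def field_simps)
      have t\<rho>: "t * ?\<rho> = R / 4" using \<rho> by (simp add: t_def)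
      define z where "z = p + t *\<^sub>R (y - p)"
      have zp: "dist z p = R / 4" using t t\<rho> by (simp add: z_def dist_norm)
      have "y - z = (1 - t) *\<^sub>R (y - p)" by (simp add: z_def algebra_simps)
      then have "dist y z = (1 - t) * ?\<rho>"
        using t by (simp add: dist_norm)
      then have yz: "dist y z = ?\<rho> - R / 4"
        using t\<rho> left_diff_distrib[of 1 t ?\<rho>] by linarith
      \<comment> \<open>p is also nearest to z, since a point of S closer to z would be closer to y
        as well.\<close>
      have "R / 4 \<le> dist z q" if "q \<in> S" for q
        using dist_triangle[of y q z] p(2)[OF that] yz by linarith
      then have "z \<in> Z" using p(1) zp by (auto simp: Z_def)
      then obtain z' where z': "z' \<in> T1" "dist z z' < \<eta> * R" using T1(4) by blast
      define q where "q = f z'"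
      have q: "q \<in> S" "dist z' q = R / 4" using f z' by (auto simp: q_def)
      have z'p: "R / 4 \<le> dist z' p" using z' T1(2) p(1) by (auto simp: Z_def)
      let ?v = "q - p" and ?w = "y - p" and ?u = "z' - z"
      \<comment> \<open>The hypotheses of \<open>nearest_centre_stable\<close> are the expanded
        squares of \<open>dist y p \<le> dist y q\<close> and
        \<open>dist z' q \<le> dist z' p\<close>.\<close>
      have "(norm ?w)\<^sup>2 \<le> (norm (?w - ?v))\<^sup>2"
        using p(2)[OF q(1)] by (intro power_mono) (auto simp: dist_norm)
      then have 1: "2 * (?v \<bullet> ?w) \<le> ?v \<bullet> ?v"
        unfolding power2_norm_eq_inner inner_diff by (simp add: inner_commute algebra_simps)
      have "(norm ((t *\<^sub>R ?w + ?u) - ?v))\<^sup>2 \<le> (norm (t *\<^sub>R ?w + ?u))\<^sup>2"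
        using q(2) z'p by (intro power_mono) (auto simp: dist_norm z_def)
      then have "?v \<bullet> ?v \<le> 2 * (?v \<bullet> (t *\<^sub>R ?w + ?u))"
        unfolding power2_norm_eq_inner inner_diff_left[of "t *\<^sub>R ?w + ?u"]
          inner_diff_right[of _ "t *\<^sub>R ?w + ?u"] inner_commute[of "t *\<^sub>R ?w + ?u" ?v] by linarith
      then have 2: "?v \<bullet> ?v \<le> 2 * t * (?v \<bullet> ?w) + 2 * (?v \<bullet> ?u)"
        by (simp only: inner_add_right inner_scaleR_right distrib_left mult.assoc)
      have "norm ?u \<le> \<eta> * R" using z'(2) by (simp add: dist_norm norm_minus_commute)
      from nearest_centre_stable[OF t 1 2 this]
      have "(dist y q)\<^sup>2 \<le> ?\<rho>\<^sup>2 + 32 * (\<eta> * R)\<^sup>2" by (simp add: dist_norm)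
      \<comment> \<open>The shrinking a = 32 * \<eta>^2 matches the stability error, and (1 - a)^2 +
        a = 1 - a * (1 - a) is still below 1.\<close>
      also have "\<dots> \<le> ((1 - a) * R)\<^sup>2 + a * R\<^sup>2"
        using power_mono[OF py, of 2] by (simp add: a_def power_mult_distrib)
      also have "\<dots> = R\<^sup>2 - a * (1 - a) * R\<^sup>2"
        by (simp add: power2_eq_square algebra_simps)
      also have "\<dots> < R\<^sup>2" using a R by simp
      finally have "dist y q < R" using R by (rule power2_less_imp_less[OF _ less_imp_le])
      then show ?thesis using z'(1) by (intro J'ball[of q]) (auto simp: q_def)
    qed
  qed
  show thesis
  proof (rule that)
    show "J' \<subseteq> J" unfolding J'_def using g(1) f(1) T2(2) by blast
    show "ball c ((1 - 32 * \<eta>\<^sup>2) * r) \<subseteq> (\<Union>(c, r)\<in>J'. ball c r)" if "(c, r) \<in> J" for c r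
      using cover[OF that] unfolding a_def by (auto simp del: UN_iff)
    have "card J' \<le> card (f ` T1 \<union> T2)"
      unfolding J'_def using T1 T2 by (intro card_image_le) auto
    also have "\<dots> \<le> card (f ` T1) + card T2" by (rule card_Un_le)
    also have "\<dots> \<le> card T1 + card T2" using T1(1) by (simp add: card_image_le)
    finally have "real (card J') * (V * \<eta> ^ (?n - 1)) \<le> real (card T1 + card T2) * (V * \<eta> ^ (?n - 1))"
      using V \<eta> by (intro mult_right_mono) auto
    also have "\<dots> \<le> real (card T1) * V * \<eta> ^ (?n - 1) + (real (card T2) * V) * 1"
      using V \<eta> by (simp add: algebra_simps mult_left_le power_le_one)
    also have "\<dots> \<le> 8 * 8 ^ ?n * measure lebesgue F + 4 ^ ?n * measure lebesgue F"
      using bound1[OF T1(1-3)] bound2[OF T2(1-3)] by linarith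
    also have "4 ^ ?n * measure lebesgue F \<le> 8 * 8 ^ ?n * measure lebesgue F"
      using power_mono[of 4 "8::real" ?n] zero_le_power[of "8::real" ?n]
      by (intro mult_right_mono measure_nonneg) linarith
    finally show "real (card J') * (unit_ball_vol ?n * R ^ ?n) * \<eta> ^ (?n - 1)
      \<le> 16 * 8 ^ ?n * measure lebesgue (\<Union>(c, r)\<in>J. ball c r)"
      by (simp add: V_def F_def mult.assoc)
  qed
qed

subsection \<open>Covering at all scales\<close>

text \<open>Restricting to exposed balls makes the unions over different dyadic scales almost disjoint.\<close>

definition exposed :: "('a::metric_space \<times> real) set \<Rightarrow> ('a \<times> real) set" where
  "exposed J = {(c, r) \<in> J. \<exists>y\<in>ball c r. \<forall>(d, s)\<in>J. 2 * r \<le> s \<longrightarrow> y \<notin> ball d s}"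

text \<open>A ball of largest radius among those containing x is exposed, with x itself as
  witness.\<close>

lemma UN_exposed:
  assumes "finite J" "\<And>c r. (c, r) \<in> J \<Longrightarrow> 0 < r"
  shows "(\<Union>(c, r)\<in>exposed J. ball c r) = (\<Union>(c, r)\<in>J. ball c r)"
proof
  show "(\<Union>(c, r)\<in>exposed J. ball c r) \<subseteq> (\<Union>(c, r)\<in>J. ball c r)"
    by (auto simp: exposed_def)
  show "(\<Union>(c, r)\<in>J. ball c r) \<subseteq> (\<Union>(c, r)\<in>exposed J. ball c r)"
  proof
    fix x assume "x \<in> (\<Union>(c, r)\<in>J. ball c r)"
    then have ne: "{p \<in> J. x \<in> ball (fst p) (snd p)} \<noteq> {}" by force
    obtain p where p: "p \<in> J" "x \<in> ball (fst p) (snd p)"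
      "\<And>q. q \<in> J \<Longrightarrow> x \<in> ball (fst q) (snd q) \<Longrightarrow> snd q \<le> snd p"
      using ex_is_arg_min_if_finite[OF _ ne, of "\<lambda>q. - snd q"] assms(1)
      by (auto simp: is_arg_min_linorder)
    obtain c r where cr: "p = (c, r)" by force
    have r: "0 < r" using assms(2) p(1) cr by auto
    have "\<not> 2 * r \<le> s" if "(d, s) \<in> J" "x \<in> ball d s" for d s
      using p(3)[OF that(1)] that(2) cr r by auto
    then have "(c, r) \<in> exposed J" using p(1,2) cr unfolding exposed_def by (auto intro!: bexI[of _ x])
    then show "x \<in> (\<Union>(c, r)\<in>exposed J. ball c r)" using p cr by force
  qed
qed

text \<open>Take for z the midpoint of the centre and a witness of exposedness; both are within half
  the radius of it. If the two small balls met, the witness for radius r would be closer to d than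
  (s + r) / 2 + (s + r) / 20, hence than s because \<open>2 * r \<le> s\<close>, and would lie in
  the larger ball.\<close>

lemma exposed_inner_balls:
  fixes J :: "('a::real_normed_vector \<times> real) set"
  assumes "\<And>c r. (c, r) \<in> J \<Longrightarrow> 0 < r"
  obtains z where
    "\<And>c r. (c, r) \<in> exposed J \<Longrightarrow> ball (z (c, r)) (r / 20) \<subseteq> ball c r"
    "\<And>c r d s. \<lbrakk>(c, r) \<in> exposed J; (d, s) \<in> exposed J; 2 * r \<le> s\<rbrakk> \<Longrightarrow>
      disjnt (ball (z (c, r)) (r / 20)) (ball (z (d, s)) (s / 20))"
proof -
  define Q where "Q p y \<longleftrightarrow> y \<in> ball (fst p) (snd p) \<and> (\<forall>(d, s)\<in>J. 2 * snd p \<le> s \<longrightarrow> y \<notin> ball d s)" for p y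
  have "\<exists>y. p \<in> exposed J \<longrightarrow> Q p y" for p
    by (cases p) (simp add: exposed_def Q_def Bex_def)
  then obtain y where Qy: "\<And>p. p \<in> exposed J \<Longrightarrow> Q p (y p)"
    by metis
  have y: "\<And>p. p \<in> exposed J \<Longrightarrow> y p \<in> ball (fst p) (snd p)"
    "\<And>p d s. \<lbrakk>p \<in> exposed J; (d, s) \<in> J; 2 * snd p \<le> s\<rbrakk> \<Longrightarrow> y p \<notin> ball d s"
    using Qy unfolding Q_def by blast+
  define z where "z p = midpoint (fst p) (y p)" for p
  have J: "0 < r" "(c, r) \<in> J" if "(c, r) \<in> exposed J" for c r
    using that assms by (auto simp: exposed_def)
  have cz: "dist c (z (c, r)) < r / 2" and yz: "dist (y (c, r)) (z (c, r)) < r / 2"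
    if "(c, r) \<in> exposed J" for c r
    using y(1)[OF that] by (auto simp: z_def dist_midpoint)
  show thesis
  proof (rule that[of z])
    fix c :: 'a and r
    assume cr: "(c, r) \<in> exposed J"
    show "ball (z (c, r)) (r / 20) \<subseteq> ball c r"
    proof
      fix x assume "x \<in> ball (z (c, r)) (r / 20)"
      then show "x \<in> ball c r"
        using cz[OF cr] J[OF cr] dist_triangle[of c x "z (c, r)"] by auto
    qed
    fix d :: 'a and s
    assume ds: "(d, s) \<in> exposed J" and rs: "2 * r \<le> s"
    have False if x: "dist (z (c, r)) x < r / 20" "dist (z (d, s)) x < s / 20" for x
    proof -
      have "s \<le> dist d (y (c, r))"
        using y(2)[OF cr J(2)[OF ds]] rs by (auto simp: not_less)
      also have "\<dots> \<le> dist d (z (d, s)) + dist (z (d, s)) x + dist x (z (c, r)) + dist (z (c, r)) (y (c, r))"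
        using dist_triangle[of d "y (c, r)" "z (d, s)"] dist_triangle[of "z (d, s)" "y (c, r)" x]
          dist_triangle[of x "y (c, r)" "z (c, r)"] by linarith
      also have "\<dots> < s / 2 + s / 20 + r / 20 + r / 2"
        using x cz[OF ds] yz[OF cr] by (simp add: dist_commute)
      finally show False using rs J(1)[OF cr] by simp
    qed
    then show "disjnt (ball (z (c, r)) (r / 20)) (ball (z (d, s)) (s / 20))"
      by (auto simp: disjnt_iff)
  qed
qed

definition dyadic_scale :: "'a \<times> real \<Rightarrow> int" where
  "dyadic_scale p = \<lfloor>log 2 (snd p)\<rfloor>"

lemma dyadic_scale_bounds:
  assumes "0 < snd p"
  shows "2 powr dyadic_scale p \<le> snd p" "snd p < 2 * 2 powr dyadic_scale p"
proof -
  have "of_int (dyadic_scale p) \<le> log 2 (snd p)" "log 2 (snd p) < of_int (dyadic_scale p) + 1"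
    by (simp_all add: dyadic_scale_def)
  then show "2 powr dyadic_scale p \<le> snd p" "snd p < 2 * 2 powr dyadic_scale p"
    using assms by (simp_all add: le_log_iff log_less_iff powr_add)
qed

text \<open>Within a scale, Vitali selects disjoint balls whose fivefold dilates cover. Passing to
  the inner balls of 1/20 the radius gives disjointness between scales too, since a gap of two in k
  separates radii by a factor of at least 2. Hence 100 = 5 * 20.\<close>

lemma sum_measure_scales_le_spread:
  fixes J :: "('a::euclidean_space \<times> real) set"
  assumes J: "finite J" "\<And>c r. (c, r) \<in> J \<Longrightarrow> 0 < r"
    and K: "finite K" "\<And>k l. \<lbrakk>k \<in> K; l \<in> K; k < l\<rbrakk> \<Longrightarrow> k + 2 \<le> l"
  shows "(\<Sum>k\<in>K. measure lebesgue (\<Union>(c, r)\<in>{p \<in> exposed J. dyadic_scale p = k}. ball c r))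
    \<le> 100 ^ DIM('a) * measure lebesgue (\<Union>(c, r)\<in>J. ball c r)"
proof -
  let ?n = "DIM('a)"
  define U where "U k = {p \<in> exposed J. dyadic_scale p = k}" for k
  have finU: "finite (U k)" for k
    using J(1) by (rule finite_subset[rotated]) (auto simp: U_def exposed_def)
  have Upos: "0 < snd p" "snd p \<le> 2 * 2 powr k" if "p \<in> U k" for p k
    using that J(2)[of "fst p" "snd p"] dyadic_scale_bounds(2)[of p] by (auto simp: U_def exposed_def)
  have "\<exists>C. C \<subseteq> U k \<and> pairwise (\<lambda>p q. disjnt (ball (fst p) (snd p)) (ball (fst q) (snd q))) C \<and>
      (\<Union>p\<in>U k. ball (fst p) (snd p)) \<subseteq> (\<Union>p\<in>C. ball (fst p) (5 * snd p))" for k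
  proof -
    have r: "0 < snd p \<and> snd p \<le> 2 * 2 powr k" if "p \<in> U k" for p
      using Upos[OF that] by blast
    show ?thesis
      by (rule Vitali_covering_lemma_balls[OF order_refl r, where a = fst]) blast+
  qed
  then have "\<forall>k. \<exists>C. C \<subseteq> U k \<and> pairwise (\<lambda>p q. disjnt (ball (fst p) (snd p)) (ball (fst q) (snd q))) C \<and>
      (\<Union>p\<in>U k. ball (fst p) (snd p)) \<subseteq> (\<Union>p\<in>C. ball (fst p) (5 * snd p))" ..
  from choice[OF this] obtain C where C: "\<And>k. C k \<subseteq> U k"
    "\<And>k. pairwise (\<lambda>p q. disjnt (ball (fst p) (snd p)) (ball (fst q) (snd q))) (C k)"
    "\<And>k. (\<Union>p\<in>U k. ball (fst p) (snd p)) \<subseteq> (\<Union>p\<in>C k. ball (fst p) (5 * snd p))"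
    by blast
  have finC: "finite (C k)" for k using C(1) finU finite_subset by blast
  obtain z where z:
    "\<And>c r. (c, r) \<in> exposed J \<Longrightarrow> ball (z (c, r)) (r / 20) \<subseteq> ball c r"
    "\<And>c r d s. \<lbrakk>(c, r) \<in> exposed J; (d, s) \<in> exposed J; 2 * r \<le> s\<rbrakk> \<Longrightarrow>
      disjnt (ball (z (c, r)) (r / 20)) (ball (z (d, s)) (s / 20))"
    using J(2) by (rule exposed_inner_balls) blast+
  define G where "G p = ball (z p) (snd p / 20)" for p
  have CJ: "p \<in> exposed J" "p \<in> J" "0 < snd p" "dyadic_scale p = k" if "p \<in> C k" for p k
    using that C(1)[of k] J(2) by (auto simp: U_def exposed_def)
  have GB: "G p \<subseteq> ball (fst p) (snd p)" if "p \<in> C k" for p k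
    using z(1)[of "fst p" "snd p"] CJ(1)[OF that] by (simp add: G_def)
  have scales: "disjnt (G p) (G q)" if pq: "p \<in> C k" "q \<in> C l" and "k \<in> K" "l \<in> K" "k < l" for p q k l
  proof -
    have "k + 2 \<le> l" using K(2) that by simp
    have "2 * snd p \<le> 2 * (2 * 2 powr k)" using dyadic_scale_bounds(2)[of p] CJ(3,4)[OF pq(1)] by simp
    also have "\<dots> = 2 powr (k + 2)" by (simp add: powr_add)
    also have "\<dots> \<le> 2 powr l" using \<open>k + 2 \<le> l\<close> by (intro powr_mono) auto
    also have "\<dots> \<le> snd q" using dyadic_scale_bounds(1)[of q] CJ(3,4)[OF pq(2)] by simp
    finally show ?thesis
      using z(2)[of "fst p" "snd p" "fst q" "snd q"] CJ(1)[OF pq(1)] CJ(1)[OF pq(2)] by (simp add: G_def)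
  qed
  have disj: "disjnt (G p) (G q)" if pq: "p \<in> C k" "q \<in> C l" and kl: "k \<in> K" "l \<in> K" and "p \<noteq> q" for p q k l
  proof -
    consider "k < l" | "l < k" | "k = l" by linarith
    then show ?thesis
    proof cases
      case 1 then show ?thesis using scales[OF pq kl] by simp
    next
      case 2 then show ?thesis using scales[OF pq(2,1) kl(2,1)] by (simp add: disjnt_sym)
    next
      case 3
      then have "disjnt (ball (fst p) (snd p)) (ball (fst q) (snd q))"
        using C(2)[of k] pq \<open>p \<noteq> q\<close> by (auto simp: pairwise_def)
      then show ?thesis using GB[OF pq(1)] GB[OF pq(2)] disjnt_subset1 disjnt_subset2 by metis
    qed
  qed
  have vol: "measure lebesgue (\<Union>(c, r)\<in>U k. ball c r) \<le> 100 ^ ?n * (\<Sum>p\<in>C k. measure lebesgue (G p))" for k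
  proof -
    have "measure lebesgue (\<Union>(c, r)\<in>U k. ball c r) \<le> measure lebesgue (\<Union>p\<in>C k. ball (fst p) (5 * snd p))"
      using C(3)[of k] finC finU
      by (intro measure_mono_fmeasurable fmeasurable.finite_UN fmeasurableD[OF lmeasurable_UN_ball]) (auto simp: case_prod_unfold)
    also have "\<dots> \<le> (\<Sum>p\<in>C k. measure lebesgue (ball (fst p) (5 * snd p)))"
      using finC by (intro measure_UNION_le) auto
    also have "\<dots> = (\<Sum>p\<in>C k. 100 ^ ?n * measure lebesgue (G p))"
    proof (intro sum.cong refl)
      fix p assume "p \<in> C k"
      then have "0 \<le> snd p" using CJ(3) by fastforce
      moreover have "(5 * snd p) ^ ?n = 100 ^ ?n * (snd p / 20) ^ ?n"
        unfolding power_mult_distrib[symmetric] by simp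
      ultimately show "measure lebesgue (ball (fst p) (5 * snd p)) = 100 ^ ?n * measure lebesgue (G p)"
        by (simp add: content_ball G_def)
    qed
    finally show ?thesis by (simp add: sum_distrib_left)
  qed
  have CC: "C k \<inter> C l = {}" if "k \<noteq> l" for k l
    using that CJ(4) by blast
  have "(\<Sum>k\<in>K. measure lebesgue (\<Union>(c, r)\<in>U k. ball c r)) \<le>
      100 ^ ?n * (\<Sum>k\<in>K. \<Sum>p\<in>C k. measure lebesgue (G p))"
    unfolding sum_distrib_left[of _ _ K] using vol by (intro sum_mono)
  also have "(\<Sum>k\<in>K. \<Sum>p\<in>C k. measure lebesgue (G p)) = (\<Sum>p\<in>(\<Union>k\<in>K. C k). measure lebesgue (G p))"
    using K(1) finC CC by (intro sum.UNION_disjoint[symmetric]) auto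
  also have "\<dots> = measure lebesgue (\<Union>p\<in>(\<Union>k\<in>K. C k). G p)"
    using K(1) finC disj by (intro measure_UNION'[symmetric]) (auto simp: pairwise_def G_def)
  also have "\<dots> \<le> measure lebesgue (\<Union>(c, r)\<in>J. ball c r)"
  proof (rule measure_mono_fmeasurable)
    show "(\<Union>p\<in>(\<Union>k\<in>K. C k). G p) \<subseteq> (\<Union>(c, r)\<in>J. ball c r)"
      using GB CJ(2) by fastforce
    show "(\<Union>p\<in>(\<Union>k\<in>K. C k). G p) \<in> sets lebesgue"
      using K(1) finC by (auto simp: G_def intro!: sets.finite_UN)
    show "(\<Union>(c, r)\<in>J. ball c r) \<in> lmeasurable"
      using lmeasurable_UN_ball[OF J(1), of "\<lambda>r. r"] .
  qed
  finally show ?thesis by (simp add: U_def)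
qed

text \<open>Distinct scales of equal parity differ by at least 2; the factor 2 pays for the two
  parity classes.\<close>

lemma sum_measure_scales_le:
  fixes J :: "('a::euclidean_space \<times> real) set"
  assumes J: "finite J" "\<And>c r. (c, r) \<in> J \<Longrightarrow> 0 < r" and K: "finite K"
  shows "(\<Sum>k\<in>K. measure lebesgue (\<Union>(c, r)\<in>{p \<in> exposed J. dyadic_scale p = k}. ball c r))
    \<le> 2 * 100 ^ DIM('a) * measure lebesgue (\<Union>(c, r)\<in>J. ball c r)"
proof -
  let ?m = "\<lambda>k. measure lebesgue (\<Union>(c, r)\<in>{p \<in> exposed J. dyadic_scale p = k}. ball c r)"
  have "sum ?m K = sum ?m {k \<in> K. even k} + sum ?m {k \<in> K. odd k}"
    using K by (subst sum.union_disjoint[symmetric]) (auto intro!: arg_cong[where f = "sum ?m"])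
  moreover have "k + 2 \<le> l" if "k < l" "even k = even l" for k l :: int
    using that by presburger
  then have "sum ?m {k \<in> K. even k} \<le> 100 ^ DIM('a) * measure lebesgue (\<Union>(c, r)\<in>J. ball c r)"
    "sum ?m {k \<in> K. odd k} \<le> 100 ^ DIM('a) * measure lebesgue (\<Union>(c, r)\<in>J. ball c r)"
    using J K by (intro sum_measure_scales_le_spread; auto)+
  ultimately show ?thesis by simp
qed

text \<open>The exposed balls of each scale k are thinned by \<open>single_scale_covering\<close>
  with R = 2^k, and the costs add up by \<open>sum_measure_scales_le\<close>.\<close>

lemma multi_scale_covering:
  fixes J :: "('a::euclidean_space \<times> real) set"
  assumes J: "finite J" "\<And>c r. (c, r) \<in> J \<Longrightarrow> 0 < r"
    and \<eta>: "0 < \<eta>" "\<eta> \<le> 1/8"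
  obtains J' where "J' \<subseteq> J"
    "(1 - 32 * \<eta>\<^sup>2) ^ DIM('a) * measure lebesgue (\<Union>(c, r)\<in>J. ball c r)
      \<le> measure lebesgue (\<Union>(c, r)\<in>J'. ball c r)"
    "\<eta> ^ (DIM('a) - 1) * (\<Sum>(c, r)\<in>J'. measure lebesgue (ball c r))
      \<le> 32 * 1600 ^ DIM('a) * measure lebesgue (\<Union>(c, r)\<in>J. ball c r)"
proof -
  let ?n = "DIM('a)"
  define F where "F = (\<Union>(c, r)\<in>J. ball c r)"
  define a where "a = 32 * \<eta>\<^sup>2"
  have a: "0 < a" "a < 1"
    using \<eta> power_mono[of \<eta> "1/8" 2] by (auto simp: a_def power2_eq_square)
  define U where "U k = {p \<in> exposed J. dyadic_scale p = k}" for k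
  have UJ: "U k \<subseteq> J" for k by (auto simp: U_def exposed_def)
  then have finU: "finite (U k)" for k using J(1) finite_subset by blast
  have sb: "2 powr k \<le> r" "r < 2 * 2 powr k" if "(c, r) \<in> U k" for c r k
    using dyadic_scale_bounds[of "(c, r)"] J(2)[of c r] UJ[of k] that by (auto simp: U_def)
  define P where "P k J' \<longleftrightarrow> J' \<subseteq> U k \<and>
    (\<forall>c r. (c, r) \<in> U k \<longrightarrow> ball c ((1 - a) * r) \<subseteq> (\<Union>(c, r)\<in>J'. ball c r)) \<and>
    real (card J') * (unit_ball_vol ?n * (2 powr k) ^ ?n) * \<eta> ^ (?n - 1)
      \<le> 16 * 8 ^ ?n * measure lebesgue (\<Union>(c, r)\<in>U k. ball c r)" for k J'
  have "\<exists>J'. P k J'" for k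
  proof -
    have R: "0 < (2::real) powr k" by simp
    have sbk: "2 powr k \<le> r" if "(c, r) \<in> U k" for c r by (rule sb(1)[OF that])
    show ?thesis
      unfolding P_def a_def
      by (rule single_scale_covering[of "U k" "2 powr k" \<eta>, OF finU _ \<eta> R], fact sbk) blast
  qed
  then obtain S where PS: "P k (S k)" for k by metis
  have S: "S k \<subseteq> U k"
    "\<And>c r. (c, r) \<in> U k \<Longrightarrow> ball c ((1 - a) * r) \<subseteq> (\<Union>(c, r)\<in>S k. ball c r)"
    "real (card (S k)) * (unit_ball_vol ?n * (2 powr k) ^ ?n) * \<eta> ^ (?n - 1)
      \<le> 16 * 8 ^ ?n * measure lebesgue (\<Union>(c, r)\<in>U k. ball c r)" for k
    using PS[of k] unfolding P_def by (simp_all only:)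
  have finS: "finite (S k)" for k using S(1) finU finite_subset by blast
  define K where "K = dyadic_scale ` exposed J"
  have finE: "finite (exposed J)"
    using J(1) by (rule finite_subset[rotated]) (auto simp: exposed_def)
  then have finK: "finite K" by (simp add: K_def)
  define J' where "J' = (\<Union>k\<in>K. S k)"
  have J'J: "J' \<subseteq> J" using S(1) UJ by (fastforce simp: J'_def)
  then have finJ': "finite J'" using J(1) finite_subset by blast
  have Fl: "(\<Union>(c, r)\<in>J'. ball c r) \<in> lmeasurable"
    using lmeasurable_UN_ball[OF finJ', of "\<lambda>r. r"] .
  show thesis
  proof (rule that[OF J'J])
    \<comment> \<open>Dilating L by 1 / (1 - a) restores the exposed balls, whose union is F, so
      shrinking keeps at least the fraction \<open>(1 - a) ^ ?n\<close> of the measure.\<close>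
    define L where "L = (\<lambda>(c, r). (c, (1 - a) * r)) ` exposed J"
    have finL: "finite L" using finE by (simp add: L_def)
    have "F = (\<Union>(c, r)\<in>exposed J. ball c r)"
      unfolding F_def using J by (intro UN_exposed[symmetric]) auto
    also have "\<dots> = (\<Union>(c, r)\<in>L. ball c (1 / (1 - a) * r))"
      using a by (simp add: L_def case_prod_unfold)
    also have "measure lebesgue \<dots> \<le> (1 / (1 - a)) ^ ?n * measure lebesgue (\<Union>(c, r)\<in>L. ball c r)"
      using a finL by (intro measure_UN_ball_dilate_le) auto
    finally have "(1 - a) ^ ?n * measure lebesgue F \<le> measure lebesgue (\<Union>(c, r)\<in>L. ball c r)"
      using a by (simp add: power_divide field_simps)
    also have "\<dots> \<le> measure lebesgue (\<Union>(c, r)\<in>J'. ball c r)"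
    proof (rule measure_mono_fmeasurable[OF _ _ Fl])
      show "(\<Union>(c, r)\<in>L. ball c r) \<in> sets lebesgue"
        using lmeasurable_UN_ball[OF finL, of "\<lambda>r. r"] by (rule fmeasurableD)
      have "ball c ((1 - a) * r) \<subseteq> (\<Union>(c, r)\<in>J'. ball c r)" if "(c, r) \<in> exposed J" for c r
        using S(2)[of c r "dyadic_scale (c, r)"] that unfolding J'_def K_def U_def by force
      then show "(\<Union>(c, r)\<in>L. ball c r) \<subseteq> (\<Union>(c, r)\<in>J'. ball c r)"
        unfolding L_def by (auto simp del: UN_iff)
    qed
    finally show "(1 - 32 * \<eta>\<^sup>2) ^ ?n * measure lebesgue (\<Union>(c, r)\<in>J. ball c r)
      \<le> measure lebesgue (\<Union>(c, r)\<in>J'. ball c r)"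
      by (simp add: a_def F_def)
  next
    have "S k \<inter> S l = {}" if "k \<noteq> l" for k l
      using that S(1) unfolding U_def by blast
    then have "(\<Sum>(c, r)\<in>J'. measure lebesgue (ball c r)) = (\<Sum>k\<in>K. \<Sum>(c, r)\<in>S k. measure lebesgue (ball c r))"
      unfolding J'_def using finK finS by (intro sum.UNION_disjoint) auto
    also have "\<dots> \<le> (\<Sum>k\<in>K. real (card (S k)) * (2 ^ ?n * (unit_ball_vol ?n * (2 powr k) ^ ?n)))"
    proof (rule sum_mono)
      fix k
      have "measure lebesgue (ball c r) \<le> 2 ^ ?n * (unit_ball_vol ?n * (2 powr k) ^ ?n)"
        if "(c, r) \<in> S k" for c r
      proof -
        have "(c, r) \<in> U k" using that S(1) by blast
        then have r: "0 \<le> r" "r \<le> 2 * 2 powr k"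
          using sb[of c r k] powr_ge_zero[of 2 "of_int k"] by linarith+
        have "measure lebesgue (ball c r) = unit_ball_vol ?n * r ^ ?n" using r by (simp add: content_ball)
        also have "\<dots> \<le> unit_ball_vol ?n * (2 * 2 powr k) ^ ?n"
          using r by (intro mult_left_mono power_mono) auto
        finally show ?thesis by (simp add: power_mult_distrib mult_ac)
      qed
      then show "(\<Sum>(c, r)\<in>S k. measure lebesgue (ball c r)) \<le>
          real (card (S k)) * (2 ^ ?n * (unit_ball_vol ?n * (2 powr k) ^ ?n))"
        by (intro sum_bounded_above) auto
    qed
    finally have "\<eta> ^ (?n - 1) * (\<Sum>(c, r)\<in>J'. measure lebesgue (ball c r)) \<le>
        \<eta> ^ (?n - 1) * (\<Sum>k\<in>K. real (card (S k)) * (2 ^ ?n * (unit_ball_vol ?n * (2 powr k) ^ ?n)))"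
      using \<eta> by (intro mult_left_mono) auto
    also have "\<dots> = (\<Sum>k\<in>K. 2 ^ ?n * (real (card (S k)) * (unit_ball_vol ?n * (2 powr k) ^ ?n) * \<eta> ^ (?n - 1)))"
      by (simp add: sum_distrib_left mult_ac)
    also have "\<dots> \<le> (\<Sum>k\<in>K. 2 ^ ?n * (16 * 8 ^ ?n * measure lebesgue (\<Union>(c, r)\<in>U k. ball c r)))"
      using S(3) by (intro sum_mono mult_left_mono) auto
    also have "\<dots> = 2 ^ ?n * (16 * 8 ^ ?n) * (\<Sum>k\<in>K. measure lebesgue (\<Union>(c, r)\<in>U k. ball c r))"
      by (simp add: sum_distrib_left mult_ac)
    also have "\<dots> \<le> 2 ^ ?n * (16 * 8 ^ ?n) * (2 * 100 ^ ?n * measure lebesgue F)"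
      unfolding U_def F_def using J finK by (intro mult_left_mono sum_measure_scales_le) auto
    \<comment> \<open>The base 2 comes from radii below twice their scale, 8 from a single scale,
      100 from decoupling the scales.\<close>
    also have "\<dots> = 32 * (2 * 8 * 100) ^ ?n * measure lebesgue F"
      unfolding power_mult_distrib by simp
    finally show "\<eta> ^ (?n - 1) * (\<Sum>(c, r)\<in>J'. measure lebesgue (ball c r))
      \<le> 32 * 1600 ^ ?n * measure lebesgue (\<Union>(c, r)\<in>J. ball c r)"
      by (simp add: F_def)
  qed
qed

subsection \<open>Bounds for the Tauberian constant\<close>

lemma hl_maximal_indicator_gt_iff:
  fixes E :: "'a::euclidean_space set"
  assumes E: "E \<in> sets lebesgue" and "0 \<le> \<alpha>"
  shows "ennreal \<alpha> < hl_maximal (indicator E) x \<longleftrightarrow>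
    (\<exists>c r. 0 < r \<and> x \<in> ball c r \<and>
      \<alpha> * measure lebesgue (ball c r) < measure lebesgue (E \<inter> ball c r))"
proof -
  have avg: "(\<integral>\<^sup>+ y \<in> ball c r. ennreal \<bar>indicator E y\<bar> \<partial>lebesgue) / emeasure lebesgue (ball c r)
      = ennreal (measure lebesgue (E \<inter> ball c r) / measure lebesgue (ball c r))"
    and pos: "0 < measure lebesgue (ball c r)" if "0 < r" for c :: 'a and r
  proof -
    show pos: "0 < measure lebesgue (ball c r)"
      using content_ball_pos[OF that] by simp
    have m: "E \<inter> ball c r \<in> lmeasurable"
      using E by (intro fmeasurableI2[OF lmeasurable_ball[of c r]]) auto
    have "(\<integral>\<^sup>+ y \<in> ball c r. ennreal \<bar>indicator E y\<bar> \<partial>lebesgue) =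
        (\<integral>\<^sup>+ y. indicator (E \<inter> ball c r) y \<partial>lebesgue)"
      by (intro nn_integral_cong) (auto simp: indicator_def)
    also have "\<dots> = emeasure lebesgue (E \<inter> ball c r)"
      using m by (intro nn_integral_indicator) (rule fmeasurableD)
    finally show "(\<integral>\<^sup>+ y \<in> ball c r. ennreal \<bar>indicator E y\<bar> \<partial>lebesgue) / emeasure lebesgue (ball c r)
      = ennreal (measure lebesgue (E \<inter> ball c r) / measure lebesgue (ball c r))"
      using emeasure_eq_measure2[OF m] emeasure_eq_measure2[OF lmeasurable_ball[of c r]] pos
      by (simp only: divide_ennreal measure_nonneg)
  qed
  have "ennreal \<alpha> < hl_maximal (indicator E) x \<longleftrightarrow>
    (\<exists>c r. 0 < r \<and> x \<in> ball c r \<and>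
      ennreal \<alpha> < ennreal (measure lebesgue (E \<inter> ball c r) / measure lebesgue (ball c r)))"
    unfolding hl_maximal_def less_SUP_iff Bex_def split_paired_Ex mem_Collect_eq case_prod_conv conj_assoc
    by (intro ex_cong1) (auto simp only: avg)
  also have "\<dots> \<longleftrightarrow> (\<exists>c r. 0 < r \<and> x \<in> ball c r \<and>
      \<alpha> * measure lebesgue (ball c r) < measure lebesgue (E \<inter> ball c r))"
    using pos assms(2) by (intro ex_cong1 conj_cong refl)
      (simp add: ennreal_less_iff pos_less_divide_eq del: measure_completion)
  finally show ?thesis .
qed

lemma hl_maximal_superlevel:
  fixes E :: "'a::euclidean_space set"
  assumes "E \<in> sets lebesgue" "0 \<le> \<alpha>"
  shows "{x. ennreal \<alpha> < hl_maximal (indicator E) x} =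
    (\<Union>(c, r)\<in>{(c, r). 0 < r \<and> \<alpha> * measure lebesgue (ball c r) < measure lebesgue (E \<inter> ball c r)}. ball c r)"
  unfolding hl_maximal_indicator_gt_iff[OF assms]
  by (rule set_eqI) (simp only: mem_Collect_eq UN_iff Bex_def split_paired_Ex case_prod_conv conj_ac)

text \<open>The first term of C is the Bernoulli loss from shrinking the balls; the second bounds
  the part of the selected balls outside E, counted with multiplicity.\<close>

lemma measure_UN_dense_balls_le:
  fixes E :: "'a::euclidean_space set" and J :: "('a \<times> real) set"
  defines "C \<equiv> 32 * real DIM('a) + 32 * 1600 ^ DIM('a)"
  assumes J: "finite J" "\<And>c r. (c, r) \<in> J \<Longrightarrow> 0 < r"
    "\<And>c r. (c, r) \<in> J \<Longrightarrow> (1 - \<eta> ^ (DIM('a) + 1)) * measure lebesgue (ball c r) < measure lebesgue (E \<inter> ball c r)"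
    and E: "E \<in> lmeasurable"
    and \<eta>: "0 < \<eta>" "\<eta> \<le> 1/8" "C * \<eta>\<^sup>2 \<le> 1/2"
  shows "measure lebesgue (\<Union>(c, r)\<in>J. ball c r) \<le> (1 + 2 * C * \<eta>\<^sup>2) * measure lebesgue E"
proof -
  let ?n = "DIM('a)"
  define V where "V = measure lebesgue (\<Union>(c, r)\<in>J. ball c r)"
  have V: "0 \<le> V" by (simp add: V_def)
  obtain J' where J': "J' \<subseteq> J" "(1 - 32 * \<eta>\<^sup>2) ^ ?n * V \<le> measure lebesgue (\<Union>(c, r)\<in>J'. ball c r)"
    "\<eta> ^ (?n - 1) * (\<Sum>(c, r)\<in>J'. measure lebesgue (ball c r)) \<le> 32 * 1600 ^ ?n * V"
    unfolding V_def by (rule multi_scale_covering[of J \<eta>]) (use J \<eta> in auto)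
  have finJ': "finite J'" using J(1) J'(1) finite_subset by blast
  have sets: "(\<Union>(c, r)\<in>J'. ball c r - E) \<in> sets lebesgue"
    using finJ' E by (intro sets.finite_UN) auto
  \<comment> \<open>The density defect beats the total measure of the selected balls, of order
    \<eta>^(1 - n), by exactly two powers.\<close>
  have eta: "\<eta> ^ (?n + 1) = \<eta>\<^sup>2 * \<eta> ^ (?n - 1)"
    using power_add[of \<eta> 2 "?n - 1"] DIM_positive[where 'a = 'a] by (simp add: Suc_diff_Suc)
  have "measure lebesgue (\<Union>(c, r)\<in>J'. ball c r) \<le> measure lebesgue (E \<union> (\<Union>(c, r)\<in>J'. ball c r - E))"
  proof (rule measure_mono_fmeasurable)
    show "E \<union> (\<Union>(c, r)\<in>J'. ball c r - E) \<in> lmeasurable"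
      using E finJ' by (intro fmeasurable.Un fmeasurable.finite_UN) (auto intro!: fmeasurable.Diff)
    show "(\<Union>(c, r)\<in>J'. ball c r) \<in> sets lebesgue"
      using lmeasurable_UN_ball[OF finJ', of "\<lambda>r. r"] by (rule fmeasurableD)
  qed auto
  also have "\<dots> \<le> measure lebesgue E + measure lebesgue (\<Union>(c, r)\<in>J'. ball c r - E)"
    using E sets by (intro measure_Un_le) auto
  also have "measure lebesgue (\<Union>(c, r)\<in>J'. ball c r - E) \<le> (\<Sum>p\<in>J'. measure lebesgue (case p of (c, r) \<Rightarrow> ball c r - E))"
    using finJ' E by (intro measure_UNION_le) auto
  also have "\<dots> \<le> (\<Sum>p\<in>J'. \<eta> ^ (?n + 1) * (case p of (c, r) \<Rightarrow> measure lebesgue (ball c r)))"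
  proof (rule sum_mono)
    fix p assume p: "p \<in> J'"
    obtain c r where cr: "p = (c, r)" by force
    have "measure lebesgue (ball c r) = measure lebesgue (E \<inter> ball c r) + measure lebesgue (ball c r - E)"
      using measure_Un2[of "E \<inter> ball c r" lebesgue "ball c r"] E
      by (simp add: fmeasurable.Int Int_Diff Diff_Int Un_absorb1 del: measure_completion)
    then show "measure lebesgue (case p of (c, r) \<Rightarrow> ball c r - E) \<le> \<eta> ^ (?n + 1) * (case p of (c, r) \<Rightarrow> measure lebesgue (ball c r))"
      using J(3)[of c r] p J'(1) cr by (auto simp: algebra_simps simp del: measure_completion)
  qed
  also have "\<dots> = \<eta>\<^sup>2 * (\<eta> ^ (?n - 1) * (\<Sum>(c, r)\<in>J'. measure lebesgue (ball c r)))"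
    unfolding eta by (simp add: sum_distrib_left mult.assoc)
  also have "\<dots> \<le> \<eta>\<^sup>2 * (32 * 1600 ^ ?n * V)"
    using J'(3) by (intro mult_left_mono) auto
  finally have "(1 - 32 * \<eta>\<^sup>2) ^ ?n * V \<le> measure lebesgue E + \<eta>\<^sup>2 * (32 * 1600 ^ ?n * V)"
    using J'(2) by linarith
  moreover have "1 + real ?n * (- 32 * \<eta>\<^sup>2) \<le> (1 + (- 32 * \<eta>\<^sup>2)) ^ ?n"
    using \<eta> power_mono[of \<eta> "1/8" 2] by (intro Bernoulli_inequality) (simp add: power2_eq_square)
  then have "(1 - 32 * real ?n * \<eta>\<^sup>2) * V \<le> (1 - 32 * \<eta>\<^sup>2) ^ ?n * V"
    using V by (intro mult_right_mono) auto
  ultimately have 1: "(1 - C * \<eta>\<^sup>2) * V \<le> measure lebesgue E"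
    by (simp add: C_def algebra_simps)
  have "0 \<le> C" by (simp add: C_def)
  then have C: "0 \<le> C * \<eta>\<^sup>2" by simp
  \<comment> \<open>This is 1 / (1 - t) \<le> 1 + 2 * t, multiplied out, for t = C * \<eta>^2
    between 0 and 1/2.\<close>
  have "1 \<le> (1 + 2 * (C * \<eta>\<^sup>2)) * (1 - C * \<eta>\<^sup>2)"
    using mult_right_mono[OF \<eta>(3) C] by (simp add: algebra_simps)
  then have "1 * V \<le> (1 + 2 * (C * \<eta>\<^sup>2)) * (1 - C * \<eta>\<^sup>2) * V"
    using V by (rule mult_right_mono)
  also have "\<dots> \<le> (1 + 2 * (C * \<eta>\<^sup>2)) * measure lebesgue E"
    using 1 C by (simp only: mult.assoc) (intro mult_left_mono, auto)
  finally show ?thesis by (simp add: V_def mult.assoc)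
qed

text \<open>By Lindelof the superlevel set is a countable union of dense balls, so the bound,
  uniform over finite subfamilies, passes to it and gives its finite measure too.\<close>

lemma tauberian_const_le:
  defines "C \<equiv> 32 * real DIM('a::euclidean_space) + 32 * 1600 ^ DIM('a)"
  assumes \<eta>: "0 < \<eta>" "\<eta> \<le> 1/8" "C * \<eta>\<^sup>2 \<le> 1/2"
  shows "tauberian_const TYPE('a) (1 - \<eta> ^ (DIM('a) + 1)) \<le> ennreal (1 + 2 * C * \<eta>\<^sup>2)"
  unfolding tauberian_const_def
proof (rule SUP_least)
  let ?\<alpha> = "1 - \<eta> ^ (DIM('a) + 1)"
  fix E :: "'a set"
  assume "E \<in> {E. E \<in> sets lebesgue \<and> 0 < emeasure lebesgue E \<and> emeasure lebesgue E < \<infinity>}"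
  then have E: "E \<in> sets lebesgue" "0 < emeasure lebesgue E" "E \<in> lmeasurable"
    by (auto simp: fmeasurable_def)
  have \<alpha>: "0 \<le> ?\<alpha>" using \<eta> by (simp add: power_le_one del: power_Suc)
  define P where "P = {(c, r). 0 < r \<and> ?\<alpha> * measure lebesgue (ball c r) < measure lebesgue (E \<inter> ball c r)}"
  define F where "F = {x. ennreal ?\<alpha> < hl_maximal (indicator E) x}"
  have F: "F = (\<Union>(c, r)\<in>P. ball c r)"
    unfolding F_def P_def using hl_maximal_superlevel[OF E(1) \<alpha>] by simp
  define b where "b p = ball (fst p) (snd p)" for p :: "'a \<times> real"
  obtain \<F> where \<F>: "\<F> \<subseteq> b ` P" "countable \<F>" "\<Union>\<F> = \<Union>(b ` P)"
    using Lindelof[of "b ` P"] by (auto simp: b_def)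
  obtain Q where Q: "countable Q" "Q \<subseteq> P" "\<F> = b ` Q"
    using \<F> countable_subset_image by metis
  have FQ: "F = (\<Union>p\<in>Q. b p)"
    using F \<F>(3) Q(3) by (auto simp: b_def case_prod_unfold)
  have bound: "measure lebesgue (\<Union>p\<in>J. b p) \<le> (1 + 2 * C * \<eta>\<^sup>2) * measure lebesgue E"
    if "J \<subseteq> Q" "finite J" for J
  proof -
    have "J \<subseteq> P" using that Q by blast
    then have "measure lebesgue (\<Union>(c, r)\<in>J. ball c r) \<le> (1 + 2 * C * \<eta>\<^sup>2) * measure lebesgue E"
      unfolding C_def using that(2) E(3) \<eta> 
      by (intro measure_UN_dense_balls_le) (auto simp: P_def C_def)
    then show ?thesis by (simp add: b_def case_prod_unfold)
  qed
  have Fm: "F \<in> lmeasurable" "measure lebesgue F \<le> (1 + 2 * C * \<eta>\<^sup>2) * measure lebesgue E"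
    unfolding FQ
    using fmeasurable_UN_bound[OF Q(1) _ bound] measure_UN_bound[OF Q(1) _ bound]
    by (simp_all add: b_def del: measure_completion)
  have "0 \<le> C" by (simp add: C_def)
  then have "emeasure lebesgue F \<le> ennreal (1 + 2 * C * \<eta>\<^sup>2) * emeasure lebesgue E"
    unfolding emeasure_eq_measure2[OF Fm(1)] emeasure_eq_measure2[OF E(3)]
    using Fm(2) by (subst ennreal_mult[symmetric]) (auto intro: ennreal_leI simp del: measure_completion)
  then show "emeasure lebesgue {x. hl_maximal (indicator E) x > ennreal ?\<alpha>} / emeasure lebesgue E
      \<le> ennreal (1 + 2 * C * \<eta>\<^sup>2)"
    using E(2) by (intro divide_le_posI_ennreal) (auto simp: F_def mult.commute)
qed


section \<open>Lower bound from the unit cube\<close>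

lemma measure_box_split_coordinate:
  fixes i :: "'a::euclidean_space"
  assumes i: "i \<in> Basis" and "\<And>b. b \<in> Basis \<Longrightarrow> l \<bullet> b \<le> u \<bullet> b"
    and "u \<bullet> i - l \<bullet> i = p" "\<And>b. \<lbrakk>b \<in> Basis; b \<noteq> i\<rbrakk> \<Longrightarrow> u \<bullet> b - l \<bullet> b = q"
  shows "measure lebesgue (box l u) = p * q ^ (DIM('a) - 1)"
proof -
  have "measure lebesgue (box l u) = (\<Prod>b\<in>Basis. (u - l) \<bullet> b)"
    using assms(2) by (simp add: measure_lborel_box)
  also have "\<dots> = p * (\<Prod>b\<in>Basis - {i}. (u - l) \<bullet> b)"
    using i assms(3) by (simp add: prod.remove[OF finite_Basis i] inner_diff_left)
  also have "(\<Prod>b\<in>Basis - {i}. (u - l) \<bullet> b) = (\<Prod>b\<in>Basis - {i}. q)"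
    using assms(4) by (intro prod.cong) (auto simp: inner_diff_left)
  finally show ?thesis using i by simp
qed

text \<open>A ball of radius \<open>1/4\<close> inside the unit cube is pushed out of a facet by \<open>h\<close>: the part
  outside lies in a box of height \<open>h\<close> and width \<open>2 * sqrt h\<close>.\<close>

lemma measure_ball_outside_cube_le:
  fixes i c :: "'a::euclidean_space"
  assumes i: "i \<in> Basis" and h: "0 < h" "h < 1/4" and ci: "c \<bullet> i = 3/4 + h"
    and cb: "\<And>b. \<lbrakk>b \<in> Basis; b \<noteq> i\<rbrakk> \<Longrightarrow> 1/4 \<le> c \<bullet> b \<and> c \<bullet> b \<le> 3/4"
  shows "measure lebesgue (ball c (1/4) - cbox 0 One) \<le> h * (2 * sqrt h) ^ (DIM('a) - 1)"
proof -
  define l where "l = (\<Sum>b\<in>Basis. (if b = i then 1 else c \<bullet> b - sqrt h) *\<^sub>R b)"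
  define u where "u = (\<Sum>b\<in>Basis. (if b = i then 1 + h else c \<bullet> b + sqrt h) *\<^sub>R b)"
  have lb: "l \<bullet> b = (if b = i then 1 else c \<bullet> b - sqrt h)"
    and ub: "u \<bullet> b = (if b = i then 1 + h else c \<bullet> b + sqrt h)" if "b \<in> Basis" for b
    using that by (simp_all add: l_def u_def)
  have "ball c (1/4) - cbox 0 One \<subseteq> box l u"
  proof
    fix y assume y: "y \<in> ball c (1/4) - cbox 0 One"
    define v where "v = y - c"
    have nv: "norm v < 1/4" using y by (simp add: v_def dist_norm norm_minus_commute)
    have vb: "\<bar>v \<bullet> b\<bar> < 1/4" if "b \<in> Basis" for b
      using Basis_le_norm[OF that, of v] nv by simp
    have yb: "y \<bullet> b = c \<bullet> b + v \<bullet> b" for b by (simp add: v_def inner_diff_left)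
    have other: "0 \<le> y \<bullet> b \<and> y \<bullet> b \<le> 1" if "b \<in> Basis" "b \<noteq> i" for b
      using cb[OF that] vb[OF that(1)] yb[of b] by linarith
    have "1 < y \<bullet> i"
    proof (rule ccontr)
      assume "\<not> 1 < y \<bullet> i"
      then have "0 \<le> y \<bullet> i \<and> y \<bullet> i \<le> 1" using vb[OF i] yb[of i] ci h by linarith
      then have "y \<in> cbox 0 One" using other by (auto simp: mem_box)
      then show False using y by simp
    qed
    then have vi: "1/4 - h < v \<bullet> i" using yb[of i] ci by linarith
    \<comment> \<open>Pythagoras in the plane of i and b leaves (1/4)^2 - (1/4 - h)^2 = h/2 - h^2
      for the square of \<open>v \<bullet> b\<close>.\<close>
    have "- sqrt h < v \<bullet> b \<and> v \<bullet> b < sqrt h" if b: "b \<in> Basis" "b \<noteq> i" for b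
    proof -
      have "(\<Sum>j\<in>{i, b}. (v \<bullet> j)\<^sup>2) \<le> (\<Sum>j\<in>Basis. (v \<bullet> j)\<^sup>2)"
        using i b by (intro sum_mono2) auto
      also have "\<dots> = (norm v)\<^sup>2"
        unfolding power2_norm_eq_inner by (simp only: euclidean_inner[of v v] power2_eq_square)
      also have "\<dots> < (1/4)\<^sup>2" using nv by (intro power_strict_mono) auto
      finally have "(v \<bullet> i)\<^sup>2 + (v \<bullet> b)\<^sup>2 < (1/4)\<^sup>2" using b by simp
      moreover have "(1/4 - h)\<^sup>2 \<le> (v \<bullet> i)\<^sup>2" using vi h by (intro power_mono) auto
      ultimately have "(v \<bullet> b)\<^sup>2 < h / 2 - h * h" by (simp add: power2_eq_square algebra_simps)
      then have "(v \<bullet> b)\<^sup>2 < h" using h mult_pos_pos[OF h(1) h(1)] by linarith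
      then have "\<bar>v \<bullet> b\<bar> < sqrt h" using real_sqrt_less_mono by fastforce
      then show ?thesis by linarith
    qed
    then show "y \<in> box l u"
      using \<open>1 < y \<bullet> i\<close> vb[OF i] yb ci by (auto simp: mem_box lb ub abs_less_iff)
  qed
  then have "measure lebesgue (ball c (1/4) - cbox 0 One) \<le> measure lebesgue (box l u)"
    by (intro measure_mono_fmeasurable) auto
  also have "\<dots> = h * (2 * sqrt h) ^ (DIM('a) - 1)"
    using i h by (intro measure_box_split_coordinate) (auto simp: lb ub)
  finally show ?thesis .
qed

text \<open>The test set is the unit cube. In \<kappa>, the bound 1/16 keeps h = \<kappa> * \<eta>^2
  below 1/4 and sqrt h below \<eta>; the other bound makes the lost cap less than the fraction
  \<open>\<eta> ^ (DIM('a) + 1)\<close> of a ball of radius 1/4. The slab gained has a base of side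
  1/2, whence the division by a power of 2.\<close>

lemma tauberian_const_ge:
  defines "\<kappa> \<equiv> min (1/16) (unit_ball_vol (DIM('a::euclidean_space)) / 8 ^ DIM('a))"
  assumes \<eta>: "0 < \<eta>" "\<eta> \<le> 1"
  shows "ennreal (1 + \<kappa> / 2 ^ (DIM('a) - 1) * \<eta>\<^sup>2) \<le> tauberian_const TYPE('a) (1 - \<eta> ^ (DIM('a) + 1))"
proof -
  let ?n = "DIM('a)" and ?\<alpha> = "1 - \<eta> ^ (DIM('a) + 1)"
  define E where "E = cbox (0::'a) One"
  have \<alpha>: "0 \<le> ?\<alpha>" "?\<alpha> < 1" using \<eta> by (simp_all add: power_le_one del: power_Suc)
  have \<kappa>: "0 < \<kappa>" "\<kappa> \<le> 1/16" "\<kappa> * 8 ^ ?n \<le> unit_ball_vol ?n"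
    by (auto simp: \<kappa>_def min_def field_simps)
  define h where "h = \<kappa> * \<eta>\<^sup>2"
  have "\<eta>\<^sup>2 \<le> 1" using \<eta> by (simp add: power_le_one)
  then have "h \<le> 1/16 * 1" unfolding h_def using \<kappa> by (intro mult_mono) auto
  then have h: "0 < h" "h < 1/4" using \<kappa> \<eta> by (auto simp: h_def)
  have sqh: "sqrt h \<le> \<eta>"
    unfolding h_def using \<kappa> \<eta> by (intro real_le_lsqrt) (auto simp: mult_le_cancel_right1)
  have E: "E \<in> lmeasurable" "emeasure lebesgue E = 1"
    by (simp_all add: E_def)
  have mE: "measure lebesgue E = 1" using E(2) by (simp add: measure_def)
  define F where "F = {x. ennreal ?\<alpha> < hl_maximal (indicator E) x}"
  have "open F"
    unfolding F_def using hl_maximal_superlevel[OF fmeasurableD[OF E(1)] \<alpha>(1)] by auto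
  obtain i :: 'a where i: "i \<in> Basis" using nonempty_Basis by blast
  define l where "l = (\<Sum>b\<in>Basis. (if b = i then 1 else 1/4) *\<^sub>R b)"
  define u where "u = (\<Sum>b\<in>Basis. (if b = i then 1 + h else 3/4) *\<^sub>R b)"
  have lb: "l \<bullet> b = (if b = i then 1 else 1/4)"
    and ub: "u \<bullet> b = (if b = i then 1 + h else 3/4)" if "b \<in> Basis" for b
    using that by (simp_all add: l_def u_def)
  have "box 0 One \<subseteq> F"
  proof
    fix x :: 'a assume "x \<in> box 0 One"
    then obtain r where r: "0 < r" "ball x r \<subseteq> box 0 One"
      using open_box openE by blast
    have "E \<inter> ball x r = ball x r" using r box_subset_cbox[of 0 One] by (auto simp: E_def)
    moreover have "?\<alpha> * measure lebesgue (ball x r) < 1 * measure lebesgue (ball x r)"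
      using \<alpha> content_ball_pos[OF r(1), of x] by (intro mult_strict_right_mono) auto
    ultimately show "x \<in> F"
      unfolding F_def mem_Collect_eq hl_maximal_indicator_gt_iff[OF fmeasurableD[OF E(1)] \<alpha>(1)]
      using r(1) by (intro exI[of _ x] exI[of _ r]) simp
  qed
  moreover have "box l u \<subseteq> F"
  proof
    fix x assume x: "x \<in> box l u"
    have xi: "1 < x \<bullet> i" "x \<bullet> i < 1 + h"
      using x i lb[OF i] ub[OF i] by (auto simp: mem_box)
    \<comment> \<open>x is moved along i to height 3/4 + h; the ball of radius 1/4 there contains x,
      whose height is between 1 and 1 + h.\<close>
    define c where "c = x + (3/4 + h - x \<bullet> i) *\<^sub>R i"
    have ci: "c \<bullet> i = 3/4 + h" using i by (simp add: c_def inner_add_left)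
    have cb: "1/4 \<le> c \<bullet> b \<and> c \<bullet> b \<le> 3/4" if "b \<in> Basis" "b \<noteq> i" for b
      using x that i lb[OF that(1)] ub[OF that(1)]
      by (auto simp: c_def inner_add_left inner_not_same_Basis mem_box less_imp_le)
    have "dist c x = \<bar>3/4 + h - x \<bullet> i\<bar>" using i by (simp add: c_def dist_norm)
    then have xc: "x \<in> ball c (1/4)" using xi h by auto
    have "measure lebesgue (ball c (1/4) - E) \<le> h * (2 * sqrt h) ^ (?n - 1)"
      unfolding E_def using i h ci cb by (rule measure_ball_outside_cube_le)
    also have "\<dots> \<le> (\<kappa> * \<eta>\<^sup>2) * (2 * \<eta>) ^ (?n - 1)"
      unfolding h_def[symmetric] using sqh h by (intro mult_left_mono power_mono) auto
    also have "\<dots> = \<kappa> * 2 ^ (?n - 1) * \<eta> ^ (?n + 1)"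
      using power_add[of \<eta> 2 "?n - 1"] DIM_positive[where 'a = 'a]
      by (simp add: power_mult_distrib Suc_diff_Suc)
    also have "\<dots> < \<kappa> * 2 ^ ?n * \<eta> ^ (?n + 1)"
      using \<kappa> \<eta> by (intro mult_strict_right_mono mult_strict_left_mono power_strict_increasing) auto
    also have "\<kappa> * 2 ^ ?n \<le> unit_ball_vol ?n * (1/4) ^ ?n"
    proof -
      have "(8::real) ^ ?n = 2 ^ ?n * 4 ^ ?n" by (simp flip: power_mult_distrib)
      then show ?thesis using \<kappa>(3) by (simp add: power_divide field_simps)
    qed
    also have "unit_ball_vol ?n * (1/4) ^ ?n = measure lebesgue (ball c (1/4))"
      by (rule measure_ball[symmetric]) simp
    finally have out: "measure lebesgue (ball c (1/4) - E) < measure lebesgue (ball c (1/4)) * \<eta> ^ (?n + 1)"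
      using \<eta> by (simp add: mult_right_mono del: measure_completion)
    have "measure lebesgue (ball c (1/4)) = measure lebesgue (E \<inter> ball c (1/4)) + measure lebesgue (ball c (1/4) - E)"
      using measure_Un2[of "E \<inter> ball c (1/4)" lebesgue "ball c (1/4)"] E
      by (simp add: fmeasurable.Int Int_Diff Diff_Int Un_absorb1 del: measure_completion)
    then have "?\<alpha> * measure lebesgue (ball c (1/4)) < measure lebesgue (E \<inter> ball c (1/4))"
      using out by (simp add: algebra_simps del: measure_completion)
    then show "x \<in> F"
      unfolding F_def mem_Collect_eq hl_maximal_indicator_gt_iff[OF fmeasurableD[OF E(1)] \<alpha>(1)]
      using xc by (intro exI[of _ c] exI[of _ "1/4"]) simp
  qed
  ultimately have "box 0 One \<union> box l u \<subseteq> F" by blast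
  then have "emeasure lebesgue (box 0 One \<union> box l u) \<le> emeasure lebesgue F"
    using \<open>open F\<close> by (intro emeasure_mono) auto
  moreover have "emeasure lebesgue (box 0 One \<union> box l u) = ennreal (1 + \<kappa> / 2 ^ (?n - 1) * \<eta>\<^sup>2)"
  proof -
    have "box 0 One \<inter> box l u = {}"
    proof -
      have "x \<bullet> i < 1" if "x \<in> box 0 One" for x using that i by (auto simp: mem_box)
      moreover have "1 < x \<bullet> i" if "x \<in> box l u" for x using that i lb[OF i] by (auto simp: mem_box)
      ultimately show ?thesis by fastforce
    qed
    moreover have "measure lebesgue (box 0 (One::'a)) = 1 * 1 ^ (?n - 1)"
      using i by (intro measure_box_split_coordinate) auto
    moreover have "measure lebesgue (box l u) = h * (1/2) ^ (?n - 1)"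
      using i h by (intro measure_box_split_coordinate) (auto simp: lb ub)
    ultimately have "measure lebesgue (box 0 One \<union> box l u) = 1 + \<kappa> / 2 ^ (?n - 1) * \<eta>\<^sup>2"
      using measure_Un3[of "box 0 One" lebesgue "box l u"]
      by (simp add: h_def power_divide del: measure_completion)
    moreover have "box 0 One \<union> box l u \<in> lmeasurable" by (intro fmeasurable.Un) auto
    ultimately show ?thesis by (simp only: emeasure_eq_measure2)
  qed
  ultimately have "ennreal (1 + \<kappa> / 2 ^ (?n - 1) * \<eta>\<^sup>2) \<le> emeasure lebesgue F / emeasure lebesgue E"
    using E(2) by (simp add: divide_ennreal_def)
  also have "\<dots> \<le> tauberian_const TYPE('a) ?\<alpha>"
    unfolding tauberian_const_def F_def by (rule SUP_upper) (use E in auto)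
  finally show ?thesis .
qed

section \<open>Choice of the constants\<close>

theorem theorem2:
  assumes "CARD('n::finite) \<ge> 2"
  shows "\<exists>c C \<alpha>\<^sub>0 :: real. 0 < c \<and> 0 < C \<and> 0 < \<alpha>\<^sub>0 \<and> \<alpha>\<^sub>0 < 1 \<and>
    (\<forall>\<alpha>. \<alpha>\<^sub>0 < \<alpha> \<and> \<alpha> < 1 \<longrightarrow>
      ereal (c * (1 - \<alpha>) powr (2 / (real CARD('n) + 1)))
        \<le> enn2ereal (tauberian_const TYPE(real ^ 'n) \<alpha>) - 1 \<and>
      enn2ereal (tauberian_const TYPE(real ^ 'n) \<alpha>) - 1
        \<le> ereal (C * (1 - \<alpha>) powr (2 / (real CARD('n) + 1))))"
proof -
  let ?n = "CARD('n)"
  let ?T = "\<lambda>\<alpha>. tauberian_const TYPE(real ^ 'n) \<alpha>"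
  define D where "D = 32 * real ?n + 32 * 1600 ^ ?n"
  define \<kappa> where "\<kappa> = min (1/16) (unit_ball_vol ?n / 8 ^ ?n) / 2 ^ (?n - 1)"
  \<comment> \<open>Below this threshold \<eta> \<le> 1/8 and D * \<eta>^2 \<le> 1/64, as required
    by \<open>tauberian_const_le\<close>.\<close>
  define \<eta>\<^sub>0 where "\<eta>\<^sub>0 = 1 / (8 * D)"
  have "1 \<le> (1600::real) ^ ?n" by simp
  then have D: "1 \<le> D" unfolding D_def by linarith
  have \<kappa>: "0 < \<kappa>" by (simp add: \<kappa>_def)
  have \<eta>\<^sub>0: "0 < \<eta>\<^sub>0" "\<eta>\<^sub>0 \<le> 1/8" using D by (auto simp: \<eta>\<^sub>0_def field_simps)
  have "\<eta>\<^sub>0 ^ (?n + 1) < 1" using \<eta>\<^sub>0 power_Suc_less_one[of \<eta>\<^sub>0 ?n] by simp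
  then have \<alpha>\<^sub>0: "0 < 1 - \<eta>\<^sub>0 ^ (?n + 1)" "1 - \<eta>\<^sub>0 ^ (?n + 1) < 1"
    using \<eta>\<^sub>0 by auto
  have bounds: "ereal (\<kappa> * (1 - \<alpha>) powr (2 / (real ?n + 1))) \<le> enn2ereal (?T \<alpha>) - 1"
    "enn2ereal (?T \<alpha>) - 1 \<le> ereal (2 * D * (1 - \<alpha>) powr (2 / (real ?n + 1)))"
    if \<alpha>: "1 - \<eta>\<^sub>0 ^ (?n + 1) < \<alpha>" "\<alpha> < 1" for \<alpha>
  proof -
    define \<eta> where "\<eta> = (1 - \<alpha>) powr (1 / (real ?n + 1))"
    have \<eta>: "0 < \<eta>" using \<alpha> by (simp add: \<eta>_def)
    have pow: "\<eta> ^ k = (1 - \<alpha>) powr (real k / (real ?n + 1))" for k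
      using \<eta> by (simp add: \<eta>_def powr_powr flip: powr_realpow)
    have "\<eta> ^ (?n + 1) = 1 - \<alpha>" using pow[of "?n + 1"] \<alpha> by (simp add: add.commute)
    then have \<alpha>_eq: "\<alpha> = 1 - \<eta> ^ (?n + 1)" by simp
    have sq: "\<eta>\<^sup>2 = (1 - \<alpha>) powr (2 / (real ?n + 1))" using pow[of 2] by simp
    have "\<eta> < \<eta>\<^sub>0"
      using \<alpha>(1) \<eta>\<^sub>0 unfolding \<alpha>_eq by (intro power_less_imp_less_base[of \<eta> "?n + 1"]) auto
    then have "D * \<eta> \<le> D * \<eta>\<^sub>0" "\<eta> \<le> 1/8" using D \<eta>\<^sub>0 by (auto intro: mult_left_mono)
    moreover have "D * \<eta>\<^sub>0 = 1/8" using D by (simp add: \<eta>\<^sub>0_def)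
    ultimately have "D * \<eta> * \<eta> \<le> 1/8 * (1/8)" "\<eta> \<le> 1/8"
      using \<eta> mult_mono[of "D * \<eta>" "1/8" \<eta> "1/8"] by simp_all
    then have small: "D * \<eta>\<^sup>2 \<le> 1/2" "\<eta> \<le> 1/8"
      by (simp_all add: power2_eq_square mult.assoc)
    have lower: "ennreal (1 + \<kappa> * \<eta>\<^sup>2) \<le> ?T \<alpha>"
      using tauberian_const_ge[where 'a = "real ^ 'n", of \<eta>] \<eta> small unfolding \<alpha>_eq \<kappa>_def by simp
    have upper: "?T \<alpha> \<le> ennreal (1 + 2 * D * \<eta>\<^sup>2)"
      using tauberian_const_le[where 'a = "real ^ 'n", of \<eta>] \<eta> small unfolding \<alpha>_eq D_def by simp
    \<comment> \<open>Writing the real bounds as differences in \<open>ereal\<close> reduces both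
      claims to monotonicity of subtracting 1; the sign of x keeps \<open>ennreal\<close> from
      truncating.\<close>
    have minus: "ereal x = enn2ereal (ennreal (1 + x)) - 1" if "0 \<le> x" for x
      using that by (subst enn2ereal_ennreal) (simp_all add: one_ereal_def)
    have "0 \<le> \<kappa> * \<eta>\<^sup>2" "0 \<le> 2 * D * \<eta>\<^sup>2" using \<kappa> D by auto
    note eqs = this[THEN minus]
    show "ereal (\<kappa> * (1 - \<alpha>) powr (2 / (real ?n + 1))) \<le> enn2ereal (?T \<alpha>) - 1"
      unfolding sq[symmetric] eqs using lower by (intro ereal_minus_mono) (simp_all add: less_eq_ennreal.rep_eq)
    show "enn2ereal (?T \<alpha>) - 1 \<le> ereal (2 * D * (1 - \<alpha>) powr (2 / (real ?n + 1)))"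
      unfolding sq[symmetric] eqs using upper by (intro ereal_minus_mono) (simp_all add: less_eq_ennreal.rep_eq)
  qed
  show ?thesis
    by (rule exI[of _ \<kappa>], rule exI[of _ "2 * D"], rule exI[of _ "1 - \<eta>\<^sub>0 ^ (?n + 1)"])
      (use \<kappa> D \<alpha>\<^sub>0 bounds in auto)
qed

end
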